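(* For $n\ge1$ let $N_n(t,q,r)=\sum_{\sigma\in\mathfrak{S}_n(321)}t^{\mathsf{exc}\,\sigma}q^{\mathsf{inv}\,\sigma}r^{\mathsf{fix}\,\sigma}$. Then for each of the five quadruples $(\tau,\mathsf{stat}_1,\mathsf{stat}_2,\mathsf{stat}_3)\in\{(321,\mathsf{exc},\mathsf{inv},\mathsf{fix}),\ (231,\mathsf{des},\mathsf{des}+(31\text{-}2),\mathsf{fmax}),\ (132,\mathsf{asc},\mathsf{asc}+(2\text{-}13),\mathsf{amax}),\ (312,\mathsf{des},\mathsf{des}+(2\text{-}31),\mathsf{amin}),\ (213,\mathsf{asc},\mathsf{asc}+(13\text{-}2),\mathsf{fmin})\}$ we have $$N_{n}(t/q, q, 1)=\sum_{\sigma\in\mathfrak{S}_{n-1}(\tau)}t^{\mathsf{stat}_1\sigma}q^{\mathsf{stat}_2\sigma}(1+t)^{\mathsf{stat}_3\sigma},$$ $$N_{n}(t, q, t)=t^n\sum_{\sigma\in\mathfrak{S}_{n-1}(\tau)}(q/t)^{\mathsf{stat}_1\sigma}q^{\mathsf{stat}_2\sigma}(1+q/t)^{\mathsf{stat}_3\sigma}.$$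
   Context: $\mathfrak{S}_m(\tau)$ is the set of permutations of $[m]$ avoiding the classical pattern $\tau$ ($\mathfrak{S}_0$ consists of the empty permutation). For $\sigma\in\mathfrak{S}_m$: $\mathsf{exc}\,\sigma=\#\{i:\sigma(i)>i\}$, $\mathsf{fix}\,\sigma=\#\{i:\sigma(i)=i\}$, $\mathsf{inv}$ is the number of inversions, $\mathsf{des}\,\sigma=\#\{i\in[m-1]:\sigma(i)>\sigma(i+1)\}$, $\mathsf{asc}\,\sigma=\#\{i\in[m-1]:\sigma(i)<\sigma(i+1)\}$. Vincular pattern counts: $(31\text{-}2)\sigma=\#\{(i,j):i+1<j\le m,\ \sigma(i+1)<\sigma(j)<\sigma(i)\}$, $(2\text{-}31)\sigma=\#\{(i,j):j<i<m,\ \sigma(i+1)<\sigma(j)<\sigma(i)\}$, $(2\text{-}13)\sigma=\#\{(i,j):j<i<m,\ \sigma(i)<\sigma(j)<\sigma(i+1)\}$, $(13\text{-}2)\sigma=\#\{(i,j):i+1<j\le m,\ \sigma(i)<\sigma(j)<\sigma(i+1)\}$. With the convention $\sigma(0)=0,\sigma(m+1)=\infty$, a value $\sigma(i)$ ($1\le i\le m$) is a double ascent if $\sigma(i-1)<\sigma(i)<\sigma(i+1)$; $\mathsf{fmax}\,\sigma$ (resp. $\mathsf{amin}\,\sigma$) is the number of such double ascents that are also left-to-right maxima (resp. right-to-left minima). With the convention $\sigma(0)=\infty,\sigma(m+1)=0$, $\sigma(i)$ is a double descent if $\sigma(i-1)>\sigma(i)>\sigma(i+1)$; $\mathsf{amax}\,\sigma$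 (resp. $\mathsf{fmin}\,\sigma$) is the number of such double descents that are also right-to-left maxima (resp. left-to-right minima). *)

theory Defs
  imports Main
begin

text \<open>A permutation of [m] is represented as the list [sigma(1), ..., sigma(m)];
  list index a (0-based) corresponds to position a+1.\<close>

definition perms :: "nat \<Rightarrow> nat list set" where
  "perms m = {xs. distinct xs \<and> set xs = {1..m}}"

definition contains :: "nat list \<Rightarrow> nat list \<Rightarrow> bool" where
  "contains p xs \<longleftrightarrow> (\<exists>is. length is = length p \<and> sorted_wrt (<) is \<and>
     (\<forall>i\<in>set is. i < length xs) \<and>
     (\<forall>a<length p. \<forall>b<length p. (xs ! (is ! a) < xs ! (is ! b) \<longleftrightarrow> p ! a < p ! b)))"

definition avoiders :: "nat \<Rightarrow> nat list \<Rightarrow> nat list set" where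
  "avoiders m p = {xs \<in> perms m. \<not> contains p xs}"

definition exc :: "nat list \<Rightarrow> nat" where
  "exc xs = card {a. a < length xs \<and> xs ! a > a + 1}"

definition fixpts :: "nat list \<Rightarrow> nat" where
  "fixpts xs = card {a. a < length xs \<and> xs ! a = a + 1}"

definition inv :: "nat list \<Rightarrow> nat" where
  "inv xs = card {(a, b). a < b \<and> b < length xs \<and> xs ! a > xs ! b}"

definition des :: "nat list \<Rightarrow> nat" where
  "des xs = card {a. a + 1 < length xs \<and> xs ! a > xs ! (a + 1)}"

definition asc :: "nat list \<Rightarrow> nat" where
  "asc xs = card {a. a + 1 < length xs \<and> xs ! a < xs ! (a + 1)}"

text \<open>Vincular patterns (0-based: pair (a,b) corresponds to (i,j) = (a+1,b+1)).\<close>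
definition vinc_31_2 :: "nat list \<Rightarrow> nat" where
  "vinc_31_2 xs = card {(a, b). a + 1 < b \<and> b < length xs \<and>
      xs ! (a + 1) < xs ! b \<and> xs ! b < xs ! a}"

definition vinc_2_31 :: "nat list \<Rightarrow> nat" where
  "vinc_2_31 xs = card {(a, b). b < a \<and> a + 1 < length xs \<and>
      xs ! (a + 1) < xs ! b \<and> xs ! b < xs ! a}"

definition vinc_2_13 :: "nat list \<Rightarrow> nat" where
  "vinc_2_13 xs = card {(a, b). b < a \<and> a + 1 < length xs \<and>
      xs ! a < xs ! b \<and> xs ! b < xs ! (a + 1)}"

definition vinc_13_2 :: "nat list \<Rightarrow> nat" where
  "vinc_13_2 xs = card {(a, b). a + 1 < b \<and> b < length xs \<and>
      xs ! a < xs ! b \<and> xs ! b < xs ! (a + 1)}"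

text \<open>Double ascent with sigma(0)=0, sigma(m+1)=infinity (values are \<ge> 1).\<close>
definition dasc :: "nat list \<Rightarrow> nat \<Rightarrow> bool" where
  "dasc xs a \<longleftrightarrow> a < length xs \<and> (a = 0 \<or> xs ! (a - 1) < xs ! a) \<and>
      (a + 1 = length xs \<or> xs ! a < xs ! (a + 1))"

text \<open>Double descent with sigma(0)=infinity, sigma(m+1)=0.\<close>
definition ddes :: "nat list \<Rightarrow> nat \<Rightarrow> bool" where
  "ddes xs a \<longleftrightarrow> a < length xs \<and> (a = 0 \<or> xs ! (a - 1) > xs ! a) \<and>
      (a + 1 = length xs \<or> xs ! a > xs ! (a + 1))"

definition lrmax :: "nat list \<Rightarrow> nat \<Rightarrow> bool" where
  "lrmax xs a \<longleftrightarrow> (\<forall>b<a. xs ! b < xs ! a)"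
definition lrmin :: "nat list \<Rightarrow> nat \<Rightarrow> bool" where
  "lrmin xs a \<longleftrightarrow> (\<forall>b<a. xs ! a < xs ! b)"
definition rlmax :: "nat list \<Rightarrow> nat \<Rightarrow> bool" where
  "rlmax xs a \<longleftrightarrow> (\<forall>b. a < b \<and> b < length xs \<longrightarrow> xs ! b < xs ! a)"
definition rlmin :: "nat list \<Rightarrow> nat \<Rightarrow> bool" where
  "rlmin xs a \<longleftrightarrow> (\<forall>b. a < b \<and> b < length xs \<longrightarrow> xs ! a < xs ! b)"

definition fmax :: "nat list \<Rightarrow> nat" where
  "fmax xs = card {a. dasc xs a \<and> lrmax xs a}"
definition amin :: "nat list \<Rightarrow> nat" where
  "amin xs = card {a. dasc xs a \<and> rlmin xs a}"
definition amax :: "nat list \<Rightarrow> nat" where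
  "amax xs = card {a. ddes xs a \<and> rlmax xs a}"
definition fmin :: "nat list \<Rightarrow> nat" where
  "fmin xs = card {a. ddes xs a \<and> lrmin xs a}"

definition N :: "nat \<Rightarrow> 'a::field \<Rightarrow> 'a \<Rightarrow> 'a \<Rightarrow> 'a" where
  "N n t q r = (\<Sum>\<sigma>\<in>avoiders n [3,2,1]. t ^ exc \<sigma> * q ^ inv \<sigma> * r ^ fixpts \<sigma>)"

end

theory Submission
  imports Defs "HOL-Computational_Algebra.Formal_Power_Series"
begin

text \<open>
  Let Y(t,z) be the power series in z with
  Y(t,z) = q z (t + (1 + t) Y(t,z) + Y(t,z) Y(t,qz)), and put
  A(t,r) = 1 / (1 - r z - z Y(t,z)). For each of the five patterns A(t,r) is the generating
  function of the avoiders weighted by the three statistics.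

  For 231 this is the decomposition of an avoider as k S T with S < k < T, because the descent from k
  into S straddles exactly the entries of S above its first letter. The patterns 132, 312, 213 follow
  by reversal and complementation. For 321, reading a permutation from left to right and recording
  the number k of skipped smaller values leads to the products
  A (1 + Y(t)) (1 + Y(tq)) ... (1 + Y(tq^(k-1))). They satisfy the required recursion because of
  (1 + Y(t,z)) (1 - t q z - z Y(tq,z)) = 1, which trades the q-shift in z for one in t.
  The same identity and the symmetry Y(t,z) = t Y(1/t,tz) yield the two formulas of the theorem.
\<close>

unbundle fps_syntax

section \<open>The power series Y and its functional equations\<close>

abbreviation dilate :: "'a::field \<Rightarrow> 'a fps \<Rightarrow> 'a fps" where
  "dilate c f \<equiv> fps_compose f (fps_const c * fps_X)"

text \<open>The equation of Y read coefficient by coefficient. At \<open>q = 1\<close> it becomes Y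
  = z (1 + Y) (t + Y), whose solution collects the Narayana polynomials.\<close>

fun narayana_coeff :: "'a::field \<Rightarrow> 'a \<Rightarrow> nat \<Rightarrow> 'a" where
  "narayana_coeff q t 0 = 0"
| "narayana_coeff q t (Suc n) = q * ((if n = 0 then t else 0) + (1 + t) * narayana_coeff q t n
     + (\<Sum>i\<le>n. narayana_coeff q t i * (q ^ (n - i) * narayana_coeff q t (n - i))))"

definition narayana_gf :: "'a::field \<Rightarrow> 'a \<Rightarrow> 'a fps" where
  "narayana_gf q t = Abs_fps (narayana_coeff q t)"

lemma narayana_gf_nth_0 [simp]: "narayana_gf q t $ 0 = 0"
  by (simp add: narayana_gf_def)

lemma dilate_nth: "dilate c f $ n = c ^ n * f $ n"
  by (simp add: fps_compose_linear)

lemma dilate_simps: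
  "dilate c (f + g) = dilate c f + dilate c g"
  "dilate c (f - g) = dilate c f - dilate c g"
  "dilate c (f * g) = dilate c f * dilate c g"
  "dilate c 1 = 1"
  "dilate c (fps_const a) = fps_const a"
  "dilate c fps_X = fps_const c * fps_X"
  by (simp_all add: fps_compose_add_distrib fps_compose_sub_distrib fps_compose_mult_distrib)

lemma const_X_mult_nth:
  "(fps_const (c :: 'a::field) * fps_X * f) $ n = (if n = 0 then 0 else c * f $ (n - 1))"
  unfolding mult.assoc fps_mult_left_const_nth by (cases n) simp_all

lemma narayana_gf_functional_equation:
  "narayana_gf q t = fps_const q * fps_X * (fps_const t + (1 + fps_const t) * narayana_gf q t + narayana_gf q t * dilate q (narayana_gf q t))"
proof (rule fps_ext)
  fix n
  show "narayana_gf q t $ n = (fps_const q * fps_X *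
      (fps_const t + (1 + fps_const t) * narayana_gf q t + narayana_gf q t * dilate q (narayana_gf q t))) $ n"
  proof (cases n)
    case (Suc k)
    have "(narayana_gf q t * dilate q (narayana_gf q t)) $ k = (\<Sum>i\<le>k. narayana_coeff q t i * (q ^ (k - i) * narayana_coeff q t (k - i)))"
      by (simp add: fps_mult_nth dilate_nth narayana_gf_def atLeast0AtMost)
    moreover have "((1 + fps_const t) * narayana_gf q t) $ k = (1 + t) * narayana_coeff q t k"
      by (simp add: narayana_gf_def distrib_right)
    ultimately show ?thesis
      unfolding const_X_mult_nth using Suc by (simp add: narayana_gf_def)
  qed (simp add: const_X_mult_nth narayana_gf_def)
qed

text \<open>The factor z on the right makes each coefficient of a solution depend on earlier
  coefficients only.\<close>

lemma narayana_gf_unique: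
  assumes "G = fps_const q * fps_X * (fps_const t + (1 + fps_const t) * G + G * dilate q G)"
  shows "G = narayana_gf q t"
proof (rule fps_ext)
  fix n
  show "G $ n = narayana_gf q t $ n"
  proof (induction n rule: less_induct)
    case (less n)
    show ?case
    proof (cases n)
      case 0
      then show ?thesis by (subst assms) (simp add: const_X_mult_nth)
    next
      case (Suc k)
      have eq: "G $ i = narayana_gf q t $ i" if "i \<le> k" for i
        using less Suc that by simp
      have "G $ n = q * ((fps_const t + (1 + fps_const t) * G + G * dilate q G) $ k)"
        using assms Suc const_X_mult_nth[of q "fps_const t + (1 + fps_const t) * G + G * dilate q G" n]
        by simp
      also have "(G * dilate q G) $ k = (narayana_gf q t * dilate q (narayana_gf q t)) $ k"
        unfolding fps_mult_nth by (intro sum.cong) (auto simp: dilate_nth eq)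
      then have "(fps_const t + (1 + fps_const t) * G + G * dilate q G) $ k
        = (fps_const t + (1 + fps_const t) * narayana_gf q t + narayana_gf q t * dilate q (narayana_gf q t)) $ k"
        by (simp add: distrib_right eq)
      also have "q * \<dots> = narayana_gf q t $ n"
        by (subst (4) narayana_gf_functional_equation) (simp add: const_X_mult_nth Suc)
      finally show ?thesis .
    qed
  qed
qed

text \<open>The inverse of the second factor, minus 1, is shown to satisfy the functional equation.\<close>

lemma narayana_gf_shift:
  "(1 + narayana_gf q t) * (1 - fps_const (t * q) * fps_X - fps_X * narayana_gf q (t * q)) = 1"
proof -
  define U where "U = 1 - fps_const (t * q) * fps_X - fps_X * narayana_gf q (t * q)"
  define V where "V = inverse U"
  have U0: "U $ 0 = 1" by (simp add: U_def)
  have UV: "U * V = 1"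
    using U0 unfolding V_def by (simp add: inverse_mult_eq_1')
  have UV': "dilate q U * dilate q V = 1"
    by (metis UV dilate_simps(3,4))
  have U0': "dilate q U \<noteq> 0" "U \<noteq> 0"
    using UV UV' by auto
  have key: "narayana_gf q (t * q) = fps_const q * fps_X *
     (fps_const (t * q) + (1 + fps_const (t * q)) * narayana_gf q (t * q) + narayana_gf q (t * q) * dilate q (narayana_gf q (t * q)))"
    by (rule narayana_gf_functional_equation)
  have dU: "dilate q U = 1 - fps_const (t * q) * (fps_const q * fps_X)
      - fps_const q * fps_X * dilate q (narayana_gf q (t * q))"
    by (simp only: U_def dilate_simps)
  have tq: "fps_const (t * q) = fps_const t * fps_const q" by simp
  \<comment> \<open>All series become named atoms, so that the rest is polynomial algebra over the
    facts \<open>1\<close> to \<open>4\<close>.\<close>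
  define W where "W = dilate q (narayana_gf q (t * q))"
  define Z where "Z = narayana_gf q (t * q)"
  define a where "a = fps_const t"
  define b where "b = fps_const q"
  define x where "x = (fps_X :: 'a fps)"
  define U1 where "U1 = dilate q U"
  define V1 where "V1 = dilate q V"
  have 1: "Z = b * x * (a * b + (1 + a * b) * Z + Z * W)"
    using key unfolding tq Z_def W_def a_def b_def x_def .
  have 2: "U1 = 1 - a * b * (b * x) - b * x * W"
    using dU unfolding tq U1_def W_def a_def b_def x_def .
  have 3: "U = 1 - a * b * x - x * Z"
    unfolding U_def tq Z_def a_def b_def x_def ..
  have 4: "U * V = 1" "U1 * V1 = 1"
    using UV UV' unfolding U1_def V1_def by auto
  \<comment> \<open>Clearing denominators: \<open>U * (V - 1) = 1 - U\<close> and
    \<open>U1 * (V1 - 1) = 1 - U1\<close> remove the inverses, and the remainder vanishes by the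
    equation of Y(tq,z). The nonzero factors \<open>U\<close> and \<open>U1\<close> are cancelled
    afterwards.\<close>
  have "U * U1 * ((V - 1) - b * x * (a + (1 + a) * (V - 1) + (V - 1) * (V1 - 1))) = 0"
  proof -
    have "U * U1 * ((V - 1) - b * x * (a + (1 + a) * (V - 1) + (V - 1) * (V1 - 1)))
       = (1 - U) * (U1 - a * b * x * U1 - b * x) - a * b * x * U * U1"
      using 4 by algebra
    also have "\<dots> = 0"
      using 1 2 3 by algebra
    finally show ?thesis .
  qed
  then have "V - 1 = b * x * (a + (1 + a) * (V - 1) + (V - 1) * (V1 - 1))"
    using U0' unfolding U1_def by simp
  then have "V - 1 = narayana_gf q t"
    by (intro narayana_gf_unique) (simp only: a_def b_def x_def V1_def dilate_simps)
  then show ?thesis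
    using UV unfolding U_def by (simp add: algebra_simps)
qed

lemma dilate_commute: "dilate a (dilate b f) = dilate b (dilate a f)"
  by (rule fps_ext) (simp add: dilate_nth mult.left_commute)

text \<open>Coefficientwise this is the palindromic symmetry y_n(t) = t^(n+1) y_n(1/t). Replacing z
  by t z in the equation for 1/t and multiplying by t yields the equation for t, because dilations
  commute; uniqueness does the rest.\<close>

lemma narayana_gf_reciprocal:
  assumes "t \<noteq> 0"
  shows "fps_const t * dilate t (narayana_gf q (1 / t)) = narayana_gf q t"
proof (rule narayana_gf_unique)
  define a s where "a = fps_const t" and "s = fps_const (1 / t)"
  have tt: "a * s = 1"
    using assms by (simp add: a_def s_def)
  define Z where "Z = dilate t (narayana_gf q (1 / t))"
  have 1: "Z = fps_const q * (a * fps_X) * (s + (1 + s) * Z + Z * dilate q Z)"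
    unfolding Z_def a_def s_def
    by (subst (1) narayana_gf_functional_equation) (simp only: dilate_simps dilate_commute[where a = t and b = q])
  show "fps_const t * dilate t (narayana_gf q (1 / t)) = fps_const q * fps_X *
    (fps_const t + (1 + fps_const t) * (fps_const t * dilate t (narayana_gf q (1 / t))) +
     fps_const t * dilate t (narayana_gf q (1 / t)) * dilate q (fps_const t * dilate t (narayana_gf q (1 / t))))"
    unfolding dilate_simps(3,5) Z_def[symmetric] unfolding a_def[symmetric] using 1 tt by algebra
qed

section \<open>The series A and its two specialisations\<close>

definition avoider_gf :: "'a::field \<Rightarrow> 'a \<Rightarrow> 'a \<Rightarrow> 'a fps" where
  "avoider_gf q t r = inverse (1 - fps_const r * fps_X - fps_X * narayana_gf q t)"

lemma avoider_gf_inverse: "avoider_gf q t r * (1 - fps_const r * fps_X - fps_X * narayana_gf q t) = 1"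
  unfolding avoider_gf_def by (rule inverse_mult_eq_1) simp

lemma avoider_gf_eqI: "G * (1 - fps_const r * fps_X - fps_X * narayana_gf q t) = 1 \<Longrightarrow> avoider_gf q t r = G"
  using avoider_gf_inverse[of q t r] by algebra

text \<open>The shift identity at t/q says 1 + Y(t/q) = 1 / (1 - t z - z Y(t)). Hence 1 - z (1 +
  Y(t/q)) is a quotient whose numerator 1 - (1 + t) z - z Y(t) is the denominator of
  A(t,1+t).\<close>

lemma avoider_gf_first:
  assumes "q \<noteq> 0"
  shows "avoider_gf q (t / q) 1 = 1 + fps_X * avoider_gf q t (1 + t)"
proof (rule avoider_gf_eqI)
  show "(1 + fps_X * avoider_gf q t (1 + t)) * (1 - fps_const 1 * fps_X - fps_X * narayana_gf q (t / q)) = 1"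
  proof -
    define A x a where "A = avoider_gf q t (1 + t)" and "x = (fps_X :: 'a fps)" and "a = fps_const t"
    have 1: "(1 + narayana_gf q (t / q)) * (1 - a * x - x * narayana_gf q t) = 1"
      using narayana_gf_shift[of q "t / q"] assms by (simp add: a_def x_def)
    have "fps_const (1 + t) = 1 + a"
      by (simp add: a_def flip: fps_const_add)
    then have 2: "A * (1 - (1 + a) * x - x * narayana_gf q t) = 1"
      using avoider_gf_inverse[of q t "1 + t"] by (simp add: A_def x_def)
    have "(1 + x * A) * (1 - x - x * narayana_gf q (t / q)) = 1"
      using 1 2 by algebra
    then show ?thesis by (simp add: A_def x_def)
  qed
qed

text \<open>The shift identity is now taken at 1/t, dilated by t and multiplied by t. With the
  reciprocal symmetry it reads (t + Y(t)) (1 - q z - t z Z) = t for Z = Y(q/t,tz), which turns 1 - z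
  (t + Y(t)) into a quotient as in the first case.\<close>

lemma avoider_gf_second:
  assumes "t \<noteq> 0"
  shows "avoider_gf q t t = 1 + fps_const t * fps_X * dilate t (avoider_gf q (q / t) (1 + q / t))"
proof (rule avoider_gf_eqI)
  define A x a b where "A = dilate t (avoider_gf q (q / t) (1 + q / t))" and "x = (fps_X :: 'a fps)"
    and "a = fps_const t" and "b = fps_const q"
  define Z where "Z = dilate t (narayana_gf q (q / t))"
  have "dilate t ((1 + narayana_gf q (1 / t)) * (1 - fps_const (1 / t * q) * fps_X - fps_X * narayana_gf q (1 / t * q))) = 1"
    unfolding narayana_gf_shift dilate_simps ..
  then have "(1 + dilate t (narayana_gf q (1 / t))) * (1 - fps_const (q / t) * (a * x) - a * x * Z) = 1"
    by (simp only: dilate_simps a_def x_def Z_def times_divide_eq_left mult_1)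
  moreover have qt: "fps_const (q / t) * a = b"
    using assms by (simp add: a_def b_def)
  moreover have "a * dilate t (narayana_gf q (1 / t)) = narayana_gf q t"
    unfolding a_def using assms by (rule narayana_gf_reciprocal)
  ultimately have 1: "(a + narayana_gf q t) * (1 - b * x - a * x * Z) = a"
    by algebra
  have "dilate t (avoider_gf q (q / t) (1 + q / t) *
     (1 - fps_const (1 + q / t) * fps_X - fps_X * narayana_gf q (q / t))) = 1"
    unfolding avoider_gf_inverse dilate_simps ..
  then have "A * (1 - fps_const (1 + q / t) * (a * x) - a * x * Z) = 1"
    by (simp only: dilate_simps a_def x_def Z_def A_def)
  moreover have "fps_const (1 + q / t) = 1 + fps_const (q / t)"
    by (simp flip: fps_const_add)
  ultimately have 2: "A * (1 - a * x - b * x - a * x * Z) = 1"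
    using qt by algebra
  show "(1 + fps_const t * fps_X * dilate t (avoider_gf q (q / t) (1 + q / t))) *
      (1 - fps_const t * fps_X - fps_X * narayana_gf q t) = 1"
    unfolding A_def[symmetric] unfolding a_def[symmetric] x_def[symmetric]
  proof -
    have "1 + a * x * A = A * (1 - b * x - a * x * Z)"
      using 2 by algebra
    then have "(1 + a * x * A) * (1 - a * x - x * narayana_gf q t)
      = A * ((1 - b * x - a * x * Z) - x * ((a + narayana_gf q t) * (1 - b * x - a * x * Z)))"
      by algebra
    also have "\<dots> = 1"
      unfolding 1 using 2 by algebra
    finally show "(1 + a * x * A) * (1 - a * x - x * narayana_gf q t) = 1" .
  qed
qed

section \<open>Coefficient recursions of A and Y\<close>

lemma X_mult_nth_Suc: "(fps_X * f) $ Suc n = (f :: 'a::field fps) $ n"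
  by simp

lemma avoider_gf_nth_0 [simp]: "avoider_gf q t r $ 0 = 1"
  by (simp add: avoider_gf_def)

text \<open>Coefficients of A = 1 + z (r + Y) A. For the pattern 231, \<open>i\<close> will be the
  length of the block S behind the first letter, and \<open>r\<close> stands for an empty
  block.\<close>

lemma avoider_gf_nth_Suc:
  "avoider_gf q t r $ Suc n = (\<Sum>i\<le>n. ((if i = 0 then r else 0) + narayana_gf q t $ i) * avoider_gf q t r $ (n - i))"
proof -
  have "avoider_gf q t r = 1 + fps_X * ((fps_const r + narayana_gf q t) * avoider_gf q t r)"
    using avoider_gf_inverse[of q t r] by algebra
  then have "avoider_gf q t r $ Suc n = (1 + fps_X * ((fps_const r + narayana_gf q t) * avoider_gf q t r)) $ Suc n"
    by simp
  also have "\<dots> = ((fps_const r + narayana_gf q t) * avoider_gf q t r) $ n"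
    by (simp only: fps_add_nth X_mult_nth_Suc) simp
  also have "\<dots> = (\<Sum>i\<le>n. ((if i = 0 then r else 0) + narayana_gf q t $ i) * avoider_gf q t r $ (n - i))"
    unfolding fps_mult_nth by (simp add: atLeast0AtMost)
  finally show ?thesis .
qed

text \<open>Collecting the terms with Y in the functional equation gives Y = t q z (1 + Y) B, where
  B is A(t,1) dilated by q, since 1 - q z - q z Y(t,qz) is the inverse of B. This form matches the
  decomposition of a block at its first letter.\<close>

lemma narayana_gf_nth_Suc:
  "narayana_gf q t $ Suc n = t * q *
     (\<Sum>i\<le>n. ((if i = 0 then 1 else 0) + narayana_gf q t $ i) * (q ^ (n - i) * avoider_gf q t 1 $ (n - i)))"
proof -
  define A where "A = dilate q (avoider_gf q t 1)"
  have "dilate q (avoider_gf q t 1 * (1 - fps_const 1 * fps_X - fps_X * narayana_gf q t)) = 1"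
    unfolding avoider_gf_inverse dilate_simps ..
  then have "A * (1 - fps_const q * fps_X - fps_const q * fps_X * dilate q (narayana_gf q t)) = 1"
    by (simp only: A_def dilate_simps fps_const_1_eq_1 mult_1)
  then have "narayana_gf q t = fps_const t * fps_const q * fps_X * ((1 + narayana_gf q t) * A)"
    using narayana_gf_functional_equation[of q t] by algebra
  then have "narayana_gf q t $ Suc n = (fps_const (t * q) * fps_X * ((1 + narayana_gf q t) * A)) $ Suc n"
    by simp
  also have "\<dots> = t * q * ((1 + narayana_gf q t) * A) $ n"
    by (simp only: const_X_mult_nth) simp
  also have "((1 + narayana_gf q t) * A) $ n =
    (\<Sum>i\<le>n. ((if i = 0 then 1 else 0) + narayana_gf q t $ i) * (q ^ (n - i) * avoider_gf q t 1 $ (n - i)))"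
    unfolding fps_mult_nth A_def by (simp add: atLeast0AtMost dilate_nth)
  finally show ?thesis .
qed

subsection \<open>Triple patterns\<close>

text \<open>Recursive in the list because words are taken apart at their first letter.\<close>

primrec triple_free :: "('a \<Rightarrow> 'a \<Rightarrow> 'a \<Rightarrow> bool) \<Rightarrow> 'a list \<Rightarrow> bool" where
  "triple_free P [] \<longleftrightarrow> True"
| "triple_free P (x # xs) \<longleftrightarrow> sorted_wrt (\<lambda>y z. \<not> P x y z) xs \<and> triple_free P xs"

lemma triple_free_iff_nth:
  "triple_free P xs \<longleftrightarrow>
     (\<forall>i j k. i < j \<longrightarrow> j < k \<longrightarrow> k < length xs \<longrightarrow> \<not> P (xs ! i) (xs ! j) (xs ! k))"
proof (induction xs)
  case (Cons x xs)
  show ?case (is "?L \<longleftrightarrow> (\<forall>i j k. ?R i j k)")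
  proof
    assume ?L
    then have "?R i j k" for i j k
      using Cons.IH by (cases i; cases j; cases k) (auto simp: sorted_wrt_iff_nth_less)
    then show "\<forall>i j k. ?R i j k" by blast
  next
    assume R: "\<forall>i j k. ?R i j k"
    have "\<not> P (xs ! i) (xs ! j) (xs ! k)" if "i < j" "j < k" "k < length xs" for i j k
      using R[rule_format, of "Suc i" "Suc j" "Suc k"] that by simp
    moreover have "\<not> P x (xs ! j) (xs ! k)" if "j < k" "k < length xs" for j k
      using R[rule_format, of 0 "Suc j" "Suc k"] that by simp
    ultimately show ?L
      using Cons.IH by (simp add: sorted_wrt_iff_nth_less)
  qed
qed simp

lemma contains_3_iff:
  "contains [a, b, c] xs \<longleftrightarrow> (\<exists>i j k. i < j \<and> j < k \<and> k < length xs \<and>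
     (xs ! i < xs ! j \<longleftrightarrow> a < b) \<and> (xs ! j < xs ! i \<longleftrightarrow> b < a) \<and>
     (xs ! i < xs ! k \<longleftrightarrow> a < c) \<and> (xs ! k < xs ! i \<longleftrightarrow> c < a) \<and>
     (xs ! j < xs ! k \<longleftrightarrow> b < c) \<and> (xs ! k < xs ! j \<longleftrightarrow> c < b))" (is "_ \<longleftrightarrow> ?R")
proof
  assume "contains [a, b, c] xs"
  then obtain "is" where "length is = 3" and sorted: "sorted_wrt (<) is"
    and bound: "\<forall>i\<in>set is. i < length xs"
    and iff: "\<forall>u<3. \<forall>v<3. (xs ! (is ! u) < xs ! (is ! v) \<longleftrightarrow> [a, b, c] ! u < [a, b, c] ! v)"
    by (auto simp: contains_def numeral_3_eq_3)
  then obtain i j k where "is = [i, j, k]"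
    by (auto simp: numeral_3_eq_3 length_Suc_conv)
  then show ?R
    using sorted bound iff by (intro exI[of _ i] exI[of _ j] exI[of _ k])
      (simp add: numeral_3_eq_3 All_less_Suc)
next
  assume ?R
  then obtain i j k where "i < j \<and> j < k \<and> k < length xs \<and>
     (xs ! i < xs ! j \<longleftrightarrow> a < b) \<and> (xs ! j < xs ! i \<longleftrightarrow> b < a) \<and>
     (xs ! i < xs ! k \<longleftrightarrow> a < c) \<and> (xs ! k < xs ! i \<longleftrightarrow> c < a) \<and>
     (xs ! j < xs ! k \<longleftrightarrow> b < c) \<and> (xs ! k < xs ! j \<longleftrightarrow> c < b)" by blast
  then show "contains [a, b, c] xs"
    unfolding contains_def by (intro exI[of _ "[i, j, k]"]) (simp add: All_less_Suc)
qed

abbreviation "free321 \<equiv> triple_free (\<lambda>x y z :: nat. z < y \<and> y < x)"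
abbreviation "free231 \<equiv> triple_free (\<lambda>x y z :: nat. z < x \<and> x < y)"

lemma avoiders_321: "avoiders n [3,2,1] = {xs. distinct xs \<and> set xs = {0<..n} \<and> free321 xs}"
proof -
  have "\<not> contains [3,2,1] xs \<longleftrightarrow> free321 xs" for xs
    unfolding contains_3_iff triple_free_iff_nth by (auto; meson less_asym' less_trans)
  then show ?thesis by (auto simp: avoiders_def perms_def atLeastSucAtMost_greaterThanAtMost)
qed

lemma avoiders_231: "avoiders n [2,3,1] = {xs. distinct xs \<and> set xs = {0<..n} \<and> free231 xs}"
proof -
  have "\<not> contains [2,3,1] xs \<longleftrightarrow> free231 xs" for xs
    unfolding contains_3_iff triple_free_iff_nth by auto
  then show ?thesis by (auto simp: avoiders_def perms_def atLeastSucAtMost_greaterThanAtMost)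
qed

section \<open>Splitting off the first letter in cardinalities of index sets\<close>

lemma card_less_Suc_shift:
  "card {a. a < Suc n \<and> P a} = (if P 0 then 1 else 0) + card {a. a < n \<and> P (Suc a)}"
proof -
  have "{a. a < Suc n \<and> P a} = (if P 0 then {0} else {}) \<union> Suc ` {a. a < n \<and> P (Suc a)}"
    by (auto simp: less_Suc_eq_0_disj)
  moreover have "card (Suc ` {a. a < n \<and> P (Suc a)}) = card {a. a < n \<and> P (Suc a)}"
    by (simp add: card_image)
  moreover have "card ((if P 0 then {0} else {}) \<union> Suc ` {a. a < n \<and> P (Suc a)}) =
      card (if P 0 then {0::nat} else {}) + card (Suc ` {a. a < n \<and> P (Suc a)})"
    by (rule card_Un_disjoint) auto
  ultimately show ?thesis by simp
qed

lemma card_pairs_Suc_shift: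
  "card {(a, b). Q a b \<and> a < b \<and> b < Suc n} =
     card {b. b < n \<and> Q 0 (Suc b)} + card {(a, b). Q (Suc a) (Suc b) \<and> a < b \<and> b < n}"
proof -
  have "{(a, b). Q a b \<and> a < b \<and> b < Suc n} =
     (\<lambda>b. (0, Suc b)) ` {b. b < n \<and> Q 0 (Suc b)} \<union>
     map_prod Suc Suc ` {(a, b). Q (Suc a) (Suc b) \<and> a < b \<and> b < n}" (is "?A = ?B \<union> ?C")
  proof (intro set_eqI iffI)
    fix p assume "p \<in> ?A"
    then show "p \<in> ?B \<union> ?C"
      by (cases "fst p"; cases "snd p") (force simp: image_iff)+
  qed auto
  moreover have "finite {(a, b). Q (Suc a) (Suc b) \<and> a < b \<and> b < n}"
    by (rule finite_subset[of _ "{..n} \<times> {..n}"]) auto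
  then have "card (?B \<union> ?C) = card ?B + card ?C"
    by (intro card_Un_disjoint) auto
  moreover have "card ?B = card {b. b < n \<and> Q 0 (Suc b)}"
    by (rule card_image) (simp add: inj_on_def)
  moreover have "card ?C = card {(a, b). Q (Suc a) (Suc b) \<and> a < b \<and> b < n}"
    by (rule card_image) (auto simp: inj_on_def)
  ultimately show ?thesis by simp
qed

lemma card_nth_distinct:
  assumes "distinct xs"
  shows "card {b. b < length xs \<and> P (xs ! b)} = card {y \<in> set xs. P y}"
proof -
  have "{y \<in> set xs. P y} = (!) xs ` {b. b < length xs \<and> P (xs ! b)}"
    by (auto simp: in_set_conv_nth)
  moreover have "inj_on ((!) xs) {b. b < length xs \<and> P (xs ! b)}"
    using inj_on_nth[OF assms] by auto
  ultimately show ?thesis by (simp add: card_image)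
qed

subsection \<open>The pattern 321\<close>

text \<open>The coefficient of z^l counts the continuations with k skipped values and l values above the
  current maximum.\<close>

primrec pending_gf :: "'a::field \<Rightarrow> 'a \<Rightarrow> 'a \<Rightarrow> nat \<Rightarrow> 'a fps" where
  "pending_gf q t r 0 = avoider_gf q t r"
| "pending_gf q t r (Suc k) = (1 + narayana_gf q (t * q ^ k)) * pending_gf q t r k"

text \<open>The factor of a new maximum with k smaller values still to come: a fixed point if k = 0,
  otherwise an excedance causing k inversions.\<close>

definition record_weight :: "'a::field \<Rightarrow> 'a \<Rightarrow> 'a \<Rightarrow> nat \<Rightarrow> 'a" where
  "record_weight q t r k = (if k = 0 then r else t * q ^ k)"

text \<open>For k = 0 this is the defining equation of A. For k = j + 1 it is the shift identity at
  t q^j, multiplied by the j-th product.\<close>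

lemma pending_gf_difference:
  "pending_gf q t r k - (if k = 0 then 1 else pending_gf q t r (k - 1)) =
     fps_X * (fps_const (record_weight q t r k) * pending_gf q t r k + (pending_gf q t r (Suc k) - pending_gf q t r k))"
proof (cases k)
  case 0
  have "avoider_gf q t r - 1 = fps_X * (fps_const r * avoider_gf q t r + ((1 + narayana_gf q t) * avoider_gf q t r - avoider_gf q t r))"
    using avoider_gf_inverse[of q t r] by algebra
  then show ?thesis
    using 0 by (simp add: record_weight_def)
next
  case (Suc j)
  define c y z P where "c = fps_const (t * q ^ k)" and "y = narayana_gf q (t * q ^ j)"
    and "z = narayana_gf q (t * q ^ k)" and "P = pending_gf q t r j"
  have "(1 + y) * (1 - c * fps_X - fps_X * z) = 1"
    using narayana_gf_shift[of q "t * q ^ j"] Suc by (simp add: mult_ac c_def y_def z_def)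
  then have "(1 + y) * P - P = fps_X * (c * ((1 + y) * P) + ((1 + z) * ((1 + y) * P) - (1 + y) * P))"
    by algebra
  then show ?thesis
    using Suc by (simp add: record_weight_def c_def y_def z_def P_def)
qed

text \<open>The first summand is for stopping or for writing the least skipped value; the j-th term
  of the sum is for a new maximum that skips j further values. The difference equation is this
  recursion telescoped along k + l.\<close>

lemma pending_gf_nth:
  "pending_gf q t r k $ l = (if k = 0 then if l = 0 then 1 else 0 else pending_gf q t r (k - 1) $ l)
     + (\<Sum>j<l. record_weight q t r (k + j) * pending_gf q t r (k + j) $ (l - 1 - j))"
proof (induction l arbitrary: k)
  case 0
  have "(pending_gf q t r k - (if k = 0 then 1 else pending_gf q t r (k - 1))) $ 0 = 0"
    unfolding pending_gf_difference by simp
  then show ?case by (simp split: if_splits)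
next
  case (Suc l)
  let ?prev = "\<lambda>k l. if k = 0 then if l = 0 then 1 else 0 else pending_gf q t r (k - 1) $ l"
  have "(pending_gf q t r k - (if k = 0 then 1 else pending_gf q t r (k - 1))) $ Suc l =
     record_weight q t r k * pending_gf q t r k $ l + (pending_gf q t r (Suc k) $ l - pending_gf q t r k $ l)"
    unfolding pending_gf_difference X_mult_nth_Suc fps_add_nth fps_sub_nth fps_mult_left_const_nth ..
  then have "pending_gf q t r k $ Suc l - ?prev k (Suc l) =
     record_weight q t r k * pending_gf q t r k $ l + (pending_gf q t r (Suc k) $ l - pending_gf q t r k $ l)"
    by (simp split: if_splits)
  \<comment> \<open>In the recursion for k + 1 the first summand is exactly the coefficient for k,
    so the difference is the sum with its index shifted by one.\<close>
  also have "pending_gf q t r (Suc k) $ l - pending_gf q t r k $ l =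
      (\<Sum>j<l. record_weight q t r (k + Suc j) * pending_gf q t r (k + Suc j) $ (l - 1 - j))"
    using Suc.IH[of "Suc k"] by simp
  also have "record_weight q t r k * pending_gf q t r k $ l + \<dots> =
      (\<Sum>j<Suc l. record_weight q t r (k + j) * pending_gf q t r (k + j) $ (Suc l - 1 - j))"
    unfolding sum.lessThan_Suc_shift by (simp add: o_def)
  finally show ?case by (simp add: algebra_simps)
qed

text \<open>\<open>p\<close> counts the letters already placed, so the head \<open>x\<close> stands
  at position \<open>p + 1\<close>.\<close>

primrec weight321 :: "'a::field \<Rightarrow> 'a \<Rightarrow> 'a \<Rightarrow> nat \<Rightarrow> nat list \<Rightarrow> 'a" where
  "weight321 q t r p [] = 1"
| "weight321 q t r p (x # xs) = (if p + 1 < x then t else 1) * (if x = p + 1 then r else 1) *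
     q ^ card {y \<in> set xs. y < x} * weight321 q t r (Suc p) xs"

lemma inv_Cons:
  assumes "distinct xs"
  shows "inv (x # xs) = card {y \<in> set xs. y < x} + inv xs"
proof -
  have "inv (x # xs) = card {(a, b). (x # xs) ! b < (x # xs) ! a \<and> a < b \<and> b < Suc (length xs)}"
    unfolding inv_def by (rule arg_cong[of _ _ card]) auto
  also have "\<dots> = card {b. b < length xs \<and> xs ! b < x} + inv xs"
    unfolding card_pairs_Suc_shift inv_def
    by (intro arg_cong2[of _ _ _ _ "(+)"] arg_cong[of _ _ card]) auto
  finally show ?thesis
    using card_nth_distinct[OF assms, of "\<lambda>y. y < x"] by simp
qed

lemma weight321_eq:
  assumes "distinct xs"
  shows "weight321 q t r p xs = t ^ card {a. a < length xs \<and> p + a + 1 < xs ! a} * q ^ inv xs *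
     r ^ card {a. a < length xs \<and> xs ! a = p + a + 1}"
  using assms
proof (induction xs arbitrary: p)
  case Nil
  then show ?case by (simp add: inv_def)
next
  case (Cons x xs)
  then show ?case
    using inv_Cons[of xs x]
      card_less_Suc_shift[of "length xs" "\<lambda>a. p + a + 1 < (x # xs) ! a"]
      card_less_Suc_shift[of "length xs" "\<lambda>a. (x # xs) ! a = p + a + 1"]
    by (simp add: power_add)
qed

text \<open>Continuations of a prefix of a 321-avoider of {1..n} whose maximum is m, where U is the set of
  values below m that the prefix has skipped.\<close>

definition pending_words :: "nat set \<Rightarrow> nat \<Rightarrow> nat \<Rightarrow> nat list set" where
  "pending_words U m n = {ys. distinct ys \<and> set ys = U \<union> {m<..n} \<and> free321 ys \<and>
     sorted_wrt (\<lambda>y z. \<not> (z < y \<and> y \<le> m)) ys}"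

lemma finite_pending_words:
  assumes "finite U"
  shows "finite (pending_words U m n)"
  by (rule finite_subset[OF _ finite_subset_distinct[of "U \<union> {m<..n}"]])
     (use assms in \<open>auto simp: pending_words_def\<close>)

text \<open>Skipped values must be written in increasing order, since a descent among them would
  form 321 with the earlier letter m. So the next letter is either \<open>Min U\<close> or a new
  maximum y, which adds the values strictly between m and y to the skipped ones.\<close>

lemma pending_words_rec:
  assumes U: "U \<subseteq> {0<..<m}" and "m \<le> n \<or> U = {}"
  shows "pending_words U m n = (if U = {} \<and> m \<ge> n then {[]} else {}) \<union>
     (if U = {} then {} else Cons (Min U) ` pending_words (U - {Min U}) m n) \<union>
     (\<Union>y\<in>{m<..n}. Cons y ` pending_words (U \<union> {m<..<y}) y n)" (is "?L = ?R")
proof (intro equalityI subsetI)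
  have fin: "finite U" using U finite_subset by blast
  fix ys assume ys: "ys \<in> ?L"
  show "ys \<in> ?R"
  proof (cases ys)
    case Nil
    then show ?thesis using ys by (auto simp: pending_words_def)
  next
    case (Cons y zs)
    have d: "y \<notin> set zs" "distinct zs" "insert y (set zs) = U \<union> {m<..n}" "free321 zs"
      "sorted_wrt (\<lambda>v w. \<not> (w < v \<and> v < y)) zs"
      "\<forall>z\<in>set zs. \<not> (z < y \<and> y \<le> m)" "sorted_wrt (\<lambda>y z. \<not> (z < y \<and> y \<le> m)) zs"
      using ys Cons by (auto simp: pending_words_def conj_commute)
    show ?thesis
    proof (cases "y \<in> U")
      case True
      then have "y \<le> m" "y \<in> U" using U by auto
      then have "y = Min U"
        using d(3,6) fin by (intro Min_eqI[symmetric]) (auto simp: not_less)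
      moreover have "set zs = U - {y} \<union> {m<..n}"
      proof -
        have "set zs = insert y (set zs) - {y}" using d(1) by simp
        also have "\<dots> = U - {y} \<union> {m<..n}"
          unfolding d(3) using \<open>y \<le> m\<close> by auto
        finally show ?thesis .
      qed
      ultimately show ?thesis
        using d True Cons by (auto simp: pending_words_def)
    next
      case False
      then have y: "m < y" "y \<le> n" using d(3) by auto
      moreover have "set zs = U \<union> {m<..<y} \<union> {y<..n}"
        using d(1,3) y False by auto
      \<comment> \<open>Avoidance of 321 starting at y orders the letters below y; as y does not
        occur again, the strict bound becomes weak.\<close>
      moreover have "sorted_wrt (\<lambda>v w. \<not> (w < v \<and> v \<le> y)) zs"
        using d(5) by (rule sorted_wrt_mono_rel[rotated]) (use d(1) in \<open>auto simp: le_less\<close>)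
      ultimately show ?thesis
        using d Cons by (auto simp: pending_words_def)
    qed
  qed
next
  have fin: "finite U" using U finite_subset by blast
  fix ys assume "ys \<in> ?R"
  then consider "U = {}" "m \<ge> n" "ys = []"
    | zs where "U \<noteq> {}" "zs \<in> pending_words (U - {Min U}) m n" "ys = Min U # zs"
    | y zs where "m < y" "y \<le> n" "zs \<in> pending_words (U \<union> {m<..<y}) y n" "ys = y # zs"
    by (elim UnE UN_E imageE) (auto split: if_splits)
  then show "ys \<in> ?L"
  proof cases
    case 1
    then show ?thesis by (auto simp: pending_words_def)
  next
    case 2
    have M: "Min U \<in> U" "\<forall>u\<in>U. Min U \<le> u"
      using 2(1) fin by auto
    then have M': "Min U < m" using U by auto
    have zs: "distinct zs" "set zs = U - {Min U} \<union> {m<..n}" "free321 zs"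
      "sorted_wrt (\<lambda>y z. \<not> (z < y \<and> y \<le> m)) zs"
      using 2(2) by (auto simp: pending_words_def)
    have "sorted_wrt (\<lambda>y z. \<not> (z < y \<and> y < Min U)) zs"
      using zs(4) by (rule sorted_wrt_mono_rel[rotated]) (use M' in auto)
    moreover have "\<forall>z\<in>set zs. \<not> z < Min U"
      using M M' zs(2) by (auto simp: not_less)
    moreover have "insert (Min U) (set zs) = U \<union> {m<..n}" "Min U \<notin> set zs"
      using M M' zs(2) by auto
    ultimately show ?thesis
      using zs 2(3) by (auto simp: pending_words_def)
  next
    case 3
    have zs: "distinct zs" "set zs = U \<union> {m<..<y} \<union> {y<..n}" "free321 zs"
      "sorted_wrt (\<lambda>v w. \<not> (w < v \<and> v \<le> y)) zs"
      using 3(3) by (auto simp: pending_words_def)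
    have "sorted_wrt (\<lambda>v w. \<not> (w < v \<and> v < y)) zs" "sorted_wrt (\<lambda>v w. \<not> (w < v \<and> v \<le> m)) zs"
      using zs(4) by (rule sorted_wrt_mono_rel[rotated]; use 3(1) in auto)+
    moreover have "insert y (set zs) = U \<union> {m<..n}" "y \<notin> set zs"
      using zs(2) 3(1,2) U by auto
    ultimately show ?thesis
      using zs 3(1,4) by (auto simp: pending_words_def)
  qed
qed

text \<open>A prefix using exactly the values up to m outside U has length
  \<open>m - card U\<close>, which fixes the starting position. Each induction step writes one of
  the \<open>card U + (n - m)\<close> remaining letters, and the three parts of
  \<open>pending_words_rec\<close> match the terms of \<open>pending_gf_nth\<close>.\<close>

lemma sum_weight321_pending_words:
  fixes q t r :: "'a::field"
  assumes "U \<subseteq> {0<..<m}" "m \<le> n"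
  shows "(\<Sum>ys\<in>pending_words U m n. weight321 q t r (m - card U) ys) = pending_gf q t r (card U) $ (n - m)"
  using assms
proof (induction "card U + (n - m)" arbitrary: U m rule: less_induct)
  case less
  note U = \<open>U \<subseteq> {0<..<m}\<close>
  have fin: "finite U" using U finite_subset by blast
  define k where "k = card U"
  have km: "k < m" if "U \<noteq> {}"
  proof -
    have "k \<le> card {0<..<m}" unfolding k_def using U by (intro card_mono) auto
    moreover have "m > 0" using that U by auto
    ultimately show ?thesis by simp
  qed
  have km': "k \<le> m" using km k_def by (cases "U = {}") auto
  let ?w = "weight321 q t r (m - k)"
  let ?A = "if U = {} \<and> m \<ge> n then {[]} else {} :: nat list set"
  let ?B = "if U = {} then {} else Cons (Min U) ` pending_words (U - {Min U}) m n"
  let ?C = "\<Union>y\<in>{m<..n}. Cons y ` pending_words (U \<union> {m<..<y}) y n"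
  have MinU: "Min U \<in> U" if "U \<noteq> {}" using fin that by auto
  have "sum ?w (pending_words U m n) = sum ?w (?A \<union> ?B \<union> ?C)"
    using pending_words_rec[OF U] less.prems(2) by simp
  also have "\<dots> = sum ?w ?A + sum ?w ?B + sum ?w ?C"
  proof -
    have "finite ?C" using fin by (auto intro!: finite_pending_words)
    moreover have "?B \<inter> ?C = {}"
    proof (cases "U = {}")
      case False
      then have "Min U < m" using MinU U by (meson greaterThanLessThan_iff subsetD)
      then show ?thesis by (force simp: False)
    qed simp
    ultimately have "sum ?w (?A \<union> ?B \<union> ?C) = sum ?w (?A \<union> ?B) + sum ?w ?C"
      using fin by (intro sum.union_disjoint finite_UnI) (simp_all add: Int_Un_distrib2 finite_pending_words)
    also have "sum ?w (?A \<union> ?B) = sum ?w ?A + sum ?w ?B"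
      using fin by (intro sum.union_disjoint) (auto intro!: finite_pending_words)
    finally show ?thesis .
  qed
  also have "sum ?w ?A + sum ?w ?B =
      (if k = 0 then if n - m = 0 then 1 else 0 else pending_gf q t r (k - 1) $ (n - m))"
  proof (cases "U = {}")
    case True
    then show ?thesis by (simp add: k_def)
  next
    case False
    define M V where "M = Min U" and "V = U - {M}"
    have M: "M \<in> U" using MinU[OF False] by (simp add: M_def)
    have k: "card V = k - 1" "k > 0"
      using M fin by (auto simp: V_def k_def card_gt_0_iff)
    \<comment> \<open>The k values of U lie between M and m - 1, so M is smaller than its position m
      - k + 1. It is neither an excedance nor a fixed point, and nothing smaller follows it, hence
      its weight is 1.\<close>
    have "M + k \<le> m"
    proof -
      have "U \<subseteq> {M..<m}" using U fin by (auto simp: M_def)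
      then have "k \<le> card {M..<m}" unfolding k_def by (intro card_mono) auto
      moreover have "M < m" using M U by (meson greaterThanLessThan_iff subsetD)
      ultimately show ?thesis by simp
    qed
    then have w: "?w (M # zs) = weight321 q t r (m - card V) zs" if "zs \<in> pending_words V m n" for zs
    proof -
      have "{y \<in> set zs. y < M} = {}"
        using that U M \<open>M + k \<le> m\<close> by (auto simp: pending_words_def V_def M_def dest: leD[OF Min_le[OF fin]])
      moreover have "Suc (m - k) = m - card V" using k \<open>M + k \<le> m\<close> by simp
      moreover have "\<not> m - k + 1 < M" "M \<noteq> m - k + 1" using \<open>M + k \<le> m\<close> by auto
      ultimately show ?thesis by (simp only: weight321.simps if_False card.empty power_0 mult_1)
    qed
    have "sum ?w ?B = (\<Sum>zs\<in>pending_words V m n. ?w (M # zs))"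
      using False by (simp add: M_def[symmetric] V_def[symmetric] sum.reindex del: weight321.simps)
    also have "\<dots> = (\<Sum>zs\<in>pending_words V m n. weight321 q t r (m - card V) zs)"
      by (rule sum.cong[OF refl w])
    also have "\<dots> = pending_gf q t r (k - 1) $ (n - m)"
      unfolding k(1)[symmetric] using U k less.prems(2)
      by (intro less.hyps) (auto simp: V_def k_def)
    finally show ?thesis using False k by simp
  qed
  also have "sum ?w ?C = (\<Sum>y\<in>{m<..n}. sum ?w (Cons y ` pending_words (U \<union> {m<..<y}) y n))"
    using fin by (intro sum.UNION_disjoint) (auto intro!: finite_pending_words)
  also have "\<dots> = (\<Sum>y\<in>{m<..n}. record_weight q t r (k + (y - Suc m)) * pending_gf q t r (k + (y - Suc m)) $ (n - y))"
  proof (rule sum.cong)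
    fix y assume y: "y \<in> {m<..n}"
    define V where "V = U \<union> {m<..<y}"
    have V: "card V = k + (y - Suc m)"
      unfolding V_def k_def using fin U by (subst card_Un_disjoint) auto
    \<comment> \<open>The smaller letters after y are exactly those of V, giving
      \<open>card V\<close> inversions. The position m - k + 1 of y equals
      \<open>y - card V\<close>, so y is fixed if V is empty and an excedance otherwise.\<close>
    have w: "?w (y # zs) = record_weight q t r (card V) * weight321 q t r (y - card V) zs" if "zs \<in> pending_words V y n" for zs
    proof -
      have "{z \<in> set zs. z < y} = V"
        using that U y by (auto simp: pending_words_def V_def)
      moreover have "Suc (m - k) = y - card V" using V km' y by auto
      moreover have "m - k + 1 < y \<longleftrightarrow> card V \<noteq> 0" "y = m - k + 1 \<longleftrightarrow> card V = 0"
        using V km' y by auto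
      ultimately show ?thesis by (auto simp: record_weight_def)
    qed
    have "sum ?w (Cons y ` pending_words V y n) = record_weight q t r (card V) * (\<Sum>zs\<in>pending_words V y n. weight321 q t r (y - card V) zs)"
      by (simp add: sum.reindex w sum_distrib_left del: weight321.simps cong: sum.cong_simp)
    also have "(\<Sum>zs\<in>pending_words V y n. weight321 q t r (y - card V) zs) = pending_gf q t r (card V) $ (n - y)"
      using V y U by (intro less.hyps) (auto simp: k_def V_def)
    finally show "sum ?w (Cons y ` pending_words (U \<union> {m<..<y}) y n) =
        record_weight q t r (k + (y - Suc m)) * pending_gf q t r (k + (y - Suc m)) $ (n - y)"
      unfolding V_def[symmetric] V .
  qed simp
  also have "\<dots> = (\<Sum>j<n - m. record_weight q t r (k + j) * pending_gf q t r (k + j) $ (n - m - 1 - j))"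
    by (rule sum.reindex_bij_witness[of _ "\<lambda>j. Suc m + j" "\<lambda>y. y - Suc m"]) auto
  finally show ?case
    unfolding k_def[symmetric] pending_gf_nth[of q t r k "n - m"] .
qed

lemma sum_avoiders_321:
  fixes q t r :: "'a::field"
  shows "(\<Sum>\<sigma>\<in>avoiders n [3,2,1]. t ^ exc \<sigma> * q ^ inv \<sigma> * r ^ fixpts \<sigma>) = avoider_gf q t r $ n"
proof -
  \<comment> \<open>For the empty prefix m is 0; all letters are positive, so the order condition is
    vacuous.\<close>
  have "avoiders n [3,2,1] = pending_words {} 0 n"
    unfolding avoiders_321 pending_words_def
    by (auto simp: sorted_wrt_iff_nth_less)
  moreover have "t ^ exc \<sigma> * q ^ inv \<sigma> * r ^ fixpts \<sigma> = weight321 q t r 0 \<sigma>" if "\<sigma> \<in> pending_words {} 0 n" for \<sigma>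
    using that weight321_eq[of \<sigma> q t r 0] by (simp add: pending_words_def exc_def fixpts_def)
  ultimately show ?thesis
    using sum_weight321_pending_words[of "{}" 0 n q t r] by simp
qed

subsection \<open>The pattern 231\<close>

lemma des_Cons: "des (x # xs) = (if xs \<noteq> [] \<and> hd xs < x then 1 else 0) + des xs"
proof (cases xs)
  case (Cons y ys)
  have "des (x # xs) = card {a. a < Suc (length ys) \<and> (x # xs) ! (a + 1) < (x # xs) ! a}"
    unfolding des_def Cons by (rule arg_cong[of _ _ card]) auto
  also have "\<dots> = (if y < x then 1 else 0) + des xs"
    unfolding card_less_Suc_shift des_def Cons by simp
  finally show ?thesis by (simp add: Cons)
qed (simp add: des_def)

text \<open>Only the adjacent pair of \<open>x\<close> and \<open>hd xs\<close> is new. For empty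
  \<open>xs\<close> the set is empty whatever \<open>hd []\<close> is.\<close>

lemma vinc_31_2_Cons:
  assumes "distinct xs"
  shows "vinc_31_2 (x # xs) = card {z \<in> set xs. hd xs < z \<and> z < x} + vinc_31_2 xs"
proof (cases xs)
  case (Cons y ys)
  let ?Q = "\<lambda>a b. a + 1 < b \<and> (x # xs) ! (a + 1) < (x # xs) ! b \<and> (x # xs) ! b < (x # xs) ! a"
  have "vinc_31_2 (x # xs) = card {(a, b). ?Q a b \<and> a < b \<and> b < Suc (length xs)}"
    unfolding vinc_31_2_def by (rule arg_cong[of _ _ card]) auto
  also have "\<dots> = card {b. b < length xs \<and> y < xs ! b \<and> xs ! b < x} + vinc_31_2 xs"
    unfolding card_pairs_Suc_shift vinc_31_2_def
    by (intro arg_cong2[of _ _ _ _ "(+)"] arg_cong[of _ _ card]) (auto simp: Cons intro: gr0I)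
  finally show ?thesis
    using card_nth_distinct[OF assms, of "\<lambda>z. y < z \<and> z < x"] by (simp add: Cons)
next
  case Nil
  have "{(a, b). a + 1 < b \<and> b < length [x] \<and> [x] ! (a + 1) < [x] ! b \<and> [x] ! b < [x] ! a} = {}"
    by auto
  then have "vinc_31_2 [x] = 0"
    unfolding vinc_31_2_def by (simp only: card.empty)
  with Nil show ?thesis by (simp add: vinc_31_2_def)
qed

text \<open>A left-to-right maximum is never preceded by a larger letter, so only the ascent on its
  right is tested. The bound m stands for the maximum of the letters before \<open>xs\<close>, which
  permits recursion on the first letter.\<close>

definition fmax_above :: "nat \<Rightarrow> nat list \<Rightarrow> nat" where
  "fmax_above m xs = card {a. a < length xs \<and> (\<forall>b<a. xs ! b < xs ! a) \<and> m < xs ! a \<and>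
     (a + 1 = length xs \<or> xs ! a < xs ! (a + 1))}"

lemma fmax_above_Nil [simp]: "fmax_above m [] = 0"
  by (simp add: fmax_above_def)

lemma fmax_above_Cons:
  "fmax_above m (x # xs) = (if m < x \<and> (xs = [] \<or> x < hd xs) then 1 else 0) + fmax_above (max m x) xs"
proof -
  have "fmax_above m (x # xs) = card {a. a < Suc (length xs) \<and> ((\<forall>b<a. (x # xs) ! b < (x # xs) ! a) \<and>
     m < (x # xs) ! a \<and> (a + 1 = Suc (length xs) \<or> (x # xs) ! a < (x # xs) ! (a + 1)))}"
    unfolding fmax_above_def by simp
  also have "\<dots> = (if m < x \<and> (xs = [] \<or> x < hd xs) then 1 else 0) + fmax_above (max m x) xs"
    unfolding card_less_Suc_shift fmax_above_def
    by (intro arg_cong2[of _ _ _ _ "(+)"] arg_cong[of _ _ card])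
       (cases xs; auto simp: All_less_Suc2)+
  finally show ?thesis .
qed

lemma fmax_eq_fmax_above:
  assumes "0 \<notin> set xs"
  shows "fmax xs = fmax_above 0 xs"
  unfolding fmax_def fmax_above_def
proof (rule arg_cong[of _ _ card], intro Collect_cong)
  fix a
  have "0 < xs ! a" if "a < length xs"
    using assms that by (metis gr0I nth_mem)
  moreover have "xs ! (a - 1) < xs ! a" if "a \<noteq> 0" "lrmax xs a"
    using that unfolding lrmax_def by auto
  ultimately show "dasc xs a \<and> lrmax xs a \<longleftrightarrow> a < length xs \<and> (\<forall>b<a. xs ! b < xs ! a) \<and>
      0 < xs ! a \<and> (a + 1 = length xs \<or> xs ! a < xs ! (a + 1))"
    unfolding dasc_def by (cases "a = 0") (auto simp: lrmax_def)
qed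

section \<open>Concatenation of a lower block S and a higher block T\<close>

lemma des_append:
  "\<forall>x\<in>set S. \<forall>y\<in>set T. x < y \<Longrightarrow> des (S @ T) = des S + des T"
  by (induction S) (auto simp: des_Cons hd_append des_def[of "[]"] dest: bspec[OF _ hd_in_set])

text \<open>No letter of T lies below the top of a descent of S, and S and T meet in an ascent, so
  no occurrence involves both.\<close>

lemma vinc_31_2_append:
  assumes "\<forall>x\<in>set S. \<forall>y\<in>set T. x < y" "distinct (S @ T)"
  shows "vinc_31_2 (S @ T) = vinc_31_2 S + vinc_31_2 T"
  using assms
proof (induction S)
  case (Cons x S)
  have "{z \<in> set (S @ T). hd (S @ T) < z \<and> z < x} = {z \<in> set S. hd S < z \<and> z < x}"
    using Cons.prems(1) by (cases S; cases T) (auto simp: less_imp_le leD)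
  then show ?case
    using Cons by (simp add: vinc_31_2_Cons del: set_append)
qed (simp add: vinc_31_2_def)

lemma fmax_above_append:
  "\<forall>x\<in>set S. x \<le> k \<Longrightarrow> fmax_above k (S @ T) = fmax_above k T"
  by (induction S) (auto simp: fmax_above_Cons max_absorb1)

lemma triple_free_appendD:
  "triple_free P (xs @ ys) \<Longrightarrow> triple_free P xs \<and> triple_free P ys"
  by (induction xs) (auto simp: sorted_wrt_append)

lemma sorted_wrt_if:
  "(\<And>y z. y \<in> set xs \<Longrightarrow> z \<in> set xs \<Longrightarrow> P y z) \<Longrightarrow> sorted_wrt P xs"
  by (simp add: sorted_wrt_iff_nth_less)

text \<open>The last letter of an occurrence of 231 is its smallest, so an occurrence starting in S
  also ends in S.\<close>

lemma free231_append:
  assumes "\<forall>x\<in>set S. \<forall>y\<in>set T. x < y" "free231 S" "free231 T"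
  shows "free231 (S @ T)"
  using assms
proof (induction S)
  case (Cons x S)
  have "sorted_wrt (\<lambda>y z. \<not> (z < x \<and> x < y)) T"
    using Cons.prems(1) by (intro sorted_wrt_if) (auto simp: not_less less_imp_le)
  then show ?case
    using Cons by (auto simp: sorted_wrt_append)
qed simp

text \<open>The offset \<open>a\<close> makes both blocks of a decomposition words of the same kind,
  without relabelling.\<close>

definition free231_words :: "nat \<Rightarrow> nat \<Rightarrow> nat list set" where
  "free231_words a n = {xs. distinct xs \<and> set xs = {a<..a + n} \<and> free231 xs}"

lemma finite_free231_words: "finite (free231_words a n)"
  by (rule finite_subset[OF _ finite_subset_distinct[of "{a<..a + n}"]]) (auto simp: free231_words_def)

lemma free231_words_0: "free231_words a 0 = {[]}"
  by (auto simp: free231_words_def)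

lemma length_free231_words: "xs \<in> free231_words a n \<Longrightarrow> length xs = n"
  by (auto simp: free231_words_def dest!: distinct_card)

text \<open>After a letter larger than the first one no smaller letter may follow, so the i letters
  below the first letter form an initial block S and the larger ones the rest T.\<close>

lemma free231_words_Suc:
  "free231_words a (Suc n) = (\<Union>i\<le>n. (\<lambda>(S, T). (a + i + 1) # S @ T) ` (free231_words a i \<times> free231_words (a + i + 1) (n - i)))"
  (is "?L = ?R")
proof (intro equalityI subsetI)
  fix xs assume xs: "xs \<in> ?L"
  then obtain x ys where Cons: "xs = x # ys"
    by (cases xs) (auto simp: free231_words_def)
  have d: "distinct ys" "x \<notin> set ys" "insert x (set ys) = {a<..a + Suc n}" "free231 ys"
    "sorted_wrt (\<lambda>y z. \<not> (z < x \<and> x < y)) ys"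
    using xs unfolding free231_words_def Cons by auto
  define i where "i = x - a - 1"
  have "x \<in> {a<..a + Suc n}"
    unfolding d(3)[symmetric] by simp
  then have x: "x = a + i + 1" "i \<le> n"
    by (auto simp: i_def)
  define S T where "S = takeWhile (\<lambda>y. y < x) ys" and "T = dropWhile (\<lambda>y. y < x) ys"
  have ys: "ys = S @ T" by (simp add: S_def T_def)
  have S: "\<forall>y\<in>set S. y < x" by (auto simp: S_def dest: set_takeWhileD)
  have T: "\<forall>y\<in>set T. x < y"
  proof (cases T)
    case (Cons h T')
    have "\<not> h < x" using Cons by (metis T_def dropWhile_eq_Cons_conv)
    moreover have "h \<noteq> x" using d(2) ys Cons by auto
    ultimately have "x < h" by simp
    moreover have "\<forall>z\<in>set T'. \<not> (z < x \<and> x < h)"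
      using d(5) unfolding ys Cons by (simp add: sorted_wrt_append)
    moreover have "x \<notin> set T'" using d(2) ys Cons by auto
    ultimately show ?thesis using Cons by (auto simp: not_less le_less)
  qed simp
  have union: "set S \<union> set T = {a<..a + Suc n} - {x}"
    using d(2,3) ys by auto
  have "set S = {a<..a + i}"
  proof -
    have "set S = (set S \<union> set T) \<inter> {y. y < x}" using S T by auto
    also have "\<dots> = {a<..a + i}"
      unfolding union x(1) using x(2) by auto
    finally show ?thesis .
  qed
  moreover have "set T = {a + i + 1<..a + i + 1 + (n - i)}"
  proof -
    have "set T = (set S \<union> set T) \<inter> {y. x < y}" using S T by auto
    also have "\<dots> = {a + i + 1<..a + i + 1 + (n - i)}"
      unfolding union x(1) using x(2) by auto
    finally show ?thesis .
  qed
  moreover have "distinct S" "distinct T" "free231 S" "free231 T"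
    using d(1,4) triple_free_appendD[of _ S T] by (simp_all add: ys)
  ultimately have "(S, T) \<in> free231_words a i \<times> free231_words (a + i + 1) (n - i)"
    by (simp add: free231_words_def)
  moreover have "xs = (\<lambda>(S, T). (a + i + 1) # S @ T) (S, T)"
    by (simp add: Cons ys x(1))
  ultimately have "xs \<in> (\<lambda>(S, T). (a + i + 1) # S @ T) ` (free231_words a i \<times> free231_words (a + i + 1) (n - i))"
    by (rule rev_image_eqI)
  then show "xs \<in> ?R"
    using x(2) by (intro UN_I) simp_all
next
  fix xs assume "xs \<in> ?R"
  then obtain i S T where i: "i \<le> n" and S: "S \<in> free231_words a i" and T: "T \<in> free231_words (a + i + 1) (n - i)"
    and xs: "xs = (a + i + 1) # S @ T" by auto
  have less: "\<forall>x\<in>set S. \<forall>y\<in>set T. x < y" using S T by (auto simp: free231_words_def)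
  have "free231 (S @ T)"
    using S T by (intro free231_append less) (auto simp: free231_words_def)
  moreover have "sorted_wrt (\<lambda>y z. \<not> (z < a + i + 1 \<and> a + i + 1 < y)) (S @ T)"
    unfolding sorted_wrt_append
    using S T by (intro conjI sorted_wrt_if) (auto simp: free231_words_def)
  moreover have "set S \<inter> set T = {}" using less by auto
  moreover have "insert (a + i + 1) (set S \<union> set T) = {a<..a + Suc n}"
    using S T i by (auto simp: free231_words_def)
  ultimately show "xs \<in> ?L"
    using S T by (auto simp: free231_words_def xs)
qed

lemma sum_free231_words_Suc:
  fixes f :: "nat list \<Rightarrow> 'a::comm_monoid_add"
  shows "sum f (free231_words a (Suc n)) =
    (\<Sum>i\<le>n. \<Sum>(S, T)\<in>free231_words a i \<times> free231_words (a + i + 1) (n - i). f ((a + i + 1) # S @ T))"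
proof -
  have "sum f (free231_words a (Suc n)) =
    (\<Sum>i\<le>n. sum f ((\<lambda>(S, T). (a + i + 1) # S @ T) ` (free231_words a i \<times> free231_words (a + i + 1) (n - i))))"
    unfolding free231_words_Suc
  proof (rule sum.UNION_disjoint)
    show "\<forall>i\<in>{..n}. finite ((\<lambda>(S, T). (a + i + 1) # S @ T) ` (free231_words a i \<times> free231_words (a + i + 1) (n - i)))"
      by (intro ballI finite_imageI finite_cartesian_product finite_free231_words)
  qed auto
  also have "\<dots> = (\<Sum>i\<le>n. \<Sum>(S, T)\<in>free231_words a i \<times> free231_words (a + i + 1) (n - i). f ((a + i + 1) # S @ T))"
  proof (rule sum.cong[OF refl])
    fix i
    \<comment> \<open>All S have the same length i, so the word determines where to cut it.\<close>
    have "inj_on (\<lambda>(S, T). (a + i + 1) # S @ T) (free231_words a i \<times> free231_words (a + i + 1) (n - i))"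
    proof (rule inj_onI)
      fix p p' assume *: "p \<in> free231_words a i \<times> free231_words (a + i + 1) (n - i)" "p' \<in> free231_words a i \<times> free231_words (a + i + 1) (n - i)"
        "(case p of (S, T) \<Rightarrow> (a + i + 1) # S @ T) = (case p' of (S, T) \<Rightarrow> (a + i + 1) # S @ T)"
      then have "length (fst p) = length (fst p')"
        using length_free231_words[of _ a i] by (simp add: mem_Times_iff)
      then show "p = p'"
        using *(3) by (simp add: case_prod_unfold prod_eq_iff)
    qed
    then show "sum f ((\<lambda>(S, T). (a + i + 1) # S @ T) ` (free231_words a i \<times> free231_words (a + i + 1) (n - i))) =
       (\<Sum>(S, T)\<in>free231_words a i \<times> free231_words (a + i + 1) (n - i). f ((a + i + 1) # S @ T))"
      by (simp only: sum.reindex o_def case_prod_unfold)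
  qed
  finally show ?thesis .
qed

definition weight231 :: "'a::field \<Rightarrow> 'a \<Rightarrow> 'a \<Rightarrow> nat \<Rightarrow> nat list \<Rightarrow> 'a" where
  "weight231 q t r m xs = t ^ des xs * q ^ (des xs + vinc_31_2 xs) * r ^ fmax_above m xs"

text \<open>The weight that a nonempty block S of values at most b contributes when it directly
  follows the letter b + 1.\<close>

definition block_weight :: "'a::field \<Rightarrow> 'a \<Rightarrow> nat \<Rightarrow> nat list \<Rightarrow> 'a" where
  "block_weight q t b S = t ^ (des S + 1) * q ^ (des S + vinc_31_2 S + 1 + (b - hd S))"

text \<open>The first letter k exceeds m and counts for \<open>fmax_above\<close> exactly when S is
  empty; letters of S stay below k and never count. Otherwise k is followed by a descent into S,
  which straddles the \<open>a + i - hd S\<close> values above \<open>hd S\<close> in S and nothing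
  in T.\<close>

lemma weight231_decompose:
  assumes S: "S \<in> free231_words a i" and T: "T \<in> free231_words (a + i + 1) j" and "m \<le> a"
  shows "weight231 q t r m ((a + i + 1) # S @ T) =
    (if S = [] then r else block_weight q t (a + i) S) * weight231 q t r (a + i + 1) T"
proof -
  define k where "k = a + i + 1"
  have less: "\<forall>x\<in>set S. \<forall>y\<in>set T. x < y" and dist: "distinct (S @ T)"
    and Sk: "\<forall>x\<in>set S. x < k" and Tk: "\<forall>y\<in>set T. k < y"
    using S T by (auto simp: free231_words_def k_def)
  have m: "max m k = k" "m < k" using \<open>m \<le> a\<close> by (simp_all add: k_def)
  have hd: "hd S < k" if "S \<noteq> []" using Sk that by simp
  have hd': "T = [] \<or> k < hd T" using Tk by (cases T) auto
  have "fmax_above k (S @ T) = fmax_above k T"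
    using Sk by (intro fmax_above_append) (simp add: less_imp_le)
  then have "fmax_above m (k # S @ T) = (if S = [] then 1 else 0) + fmax_above k T"
    unfolding fmax_above_Cons m(1) using m(2) hd hd' by (cases "S = []") (auto simp: not_less less_imp_le)
  moreover have "des (k # S @ T) = (if S = [] then 0 else 1) + des S + des T"
    unfolding des_Cons des_append[OF less] using hd hd'
    by (cases "S = []") (auto simp: not_less less_imp_le)
  moreover have "vinc_31_2 (k # S @ T) =
     (if S = [] then 0 else a + i - hd S) + vinc_31_2 S + vinc_31_2 T"
  proof -
    have "{z \<in> set (S @ T). hd (S @ T) < z \<and> z < k} = (if S = [] then {} else {hd S<..a + i})"
      using S Tk hd_in_set[of S] by (cases "S = []") (auto simp: free231_words_def k_def)
    then show ?thesis
      unfolding vinc_31_2_Cons[OF dist] vinc_31_2_append[OF less dist] by simp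
  qed
  moreover have "des [] = 0" "vinc_31_2 [] = 0" by (simp_all add: des_def vinc_31_2_def)
  ultimately show ?thesis
    unfolding k_def[symmetric]
    by (simp add: weight231_def block_weight_def power_add mult_ac)
qed

lemma free231_words_nonempty_list: "0 < n \<Longrightarrow> [] \<notin> free231_words a n"
  by (auto simp: free231_words_def)

text \<open>Simultaneous induction: words follow \<open>avoider_gf_nth_Suc\<close> and blocks
  \<open>narayana_gf_nth_Suc\<close>. The quantities \<open>a\<close>, \<open>m\<close> and
  \<open>r\<close> vary because T starts at a new offset, k becomes its bound, and blocks are
  counted with \<open>r = 1\<close>.\<close>

lemma sum_free231_words:
  fixes q t r :: "'a::field"
  shows "m \<le> a \<Longrightarrow> (\<Sum>xs\<in>free231_words a n. weight231 q t r m xs) = avoider_gf q t r $ n"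
    and "n > 0 \<Longrightarrow> (\<Sum>xs\<in>free231_words a n. block_weight q t (a + n) xs) = narayana_gf q t $ n"
proof (induction n arbitrary: a m r rule: less_induct)
  case (less n)
  have block: "(\<Sum>S\<in>free231_words a i. if S = [] then s else block_weight q t (a + i) S) =
     (if i = 0 then s else 0) + narayana_gf q t $ i" if "i < n" for i s and a
  proof (cases "i = 0")
    case True
    then show ?thesis by (simp add: free231_words_0)
  next
    case False
    then have "(\<Sum>S\<in>free231_words a i. if S = [] then s else block_weight q t (a + i) S) =
       (\<Sum>S\<in>free231_words a i. block_weight q t (a + i) S)"
      by (intro sum.cong) (auto dest: free231_words_nonempty_list[of i a])
    then show ?thesis
      using less.IH(2)[OF that] False by simp
  qed
  { case 1 show ?case
  proof (cases n)
    case 0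
    then show ?thesis
      by (simp add: free231_words_0 weight231_def des_def vinc_31_2_def)
  next
    case (Suc k)
    have "(\<Sum>xs\<in>free231_words a n. weight231 q t r m xs) =
      (\<Sum>i\<le>k. (\<Sum>S\<in>free231_words a i. if S = [] then r else block_weight q t (a + i) S) *
         (\<Sum>T\<in>free231_words (a + i + 1) (k - i). weight231 q t r (a + i + 1) T))"
      unfolding Suc sum_free231_words_Suc sum_product sum.cartesian_product
      by (intro sum.cong refl, simp only: mem_Times_iff case_prod_unfold, elim conjE)
        (rule weight231_decompose[OF _ _ 1])
    also have "\<dots> = (\<Sum>i\<le>k. ((if i = 0 then r else 0) + narayana_gf q t $ i) * avoider_gf q t r $ (k - i))"
      using Suc by (intro sum.cong) (simp_all add: block less.IH(1))
    finally show ?thesis unfolding Suc avoider_gf_nth_Suc .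
  qed }
  { case 2 show ?case
  proof -
    obtain k where Suc: "n = Suc k" using 2 by (cases n) auto
    \<comment> \<open>With head a + i + 1 and top value a + k + 1, the block has k - i values above
      its head; these form T and supply the additional power of q.\<close>
    have *: "block_weight q t (a + Suc k) ((a + i + 1) # xs) =
        t * q ^ (1 + (k - i)) * weight231 q t 1 a ((a + i + 1) # xs)" for i xs
      by (simp add: block_weight_def weight231_def power_add mult_ac)
    have "(\<Sum>xs\<in>free231_words a n. block_weight q t (a + n) xs) =
      (\<Sum>i\<le>k. t * q ^ (1 + (k - i)) * ((\<Sum>S\<in>free231_words a i. if S = [] then 1 else block_weight q t (a + i) S) *
         (\<Sum>T\<in>free231_words (a + i + 1) (k - i). weight231 q t 1 (a + i + 1) T)))"
      unfolding Suc sum_free231_words_Suc sum_product sum.cartesian_product *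
      by (intro sum.cong refl, simp only: sum_distrib_left case_prod_unfold, intro sum.cong refl,
          simp only: mem_Times_iff, elim conjE)
        (rule arg_cong[OF weight231_decompose[OF _ _ order_refl]])
    also have "\<dots> = (\<Sum>i\<le>k. t * q ^ (1 + (k - i)) * (((if i = 0 then 1 else 0) + narayana_gf q t $ i) * avoider_gf q t 1 $ (k - i)))"
      using Suc by (intro sum.cong) (simp_all add: block less.IH(1))
    also have "\<dots> = narayana_gf q t $ n"
      unfolding Suc narayana_gf_nth_Suc sum_distrib_left by (intro sum.cong) (simp_all add: mult_ac)
    finally show ?thesis .
  qed }
qed

lemma sum_avoiders_231:
  fixes q t r :: "'a::field"
  shows "(\<Sum>\<sigma>\<in>avoiders n [2,3,1]. t ^ des \<sigma> * q ^ (des \<sigma> + vinc_31_2 \<sigma>) * r ^ fmax \<sigma>) = avoider_gf q t r $ n"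
proof -
  have "avoiders n [2,3,1] = free231_words 0 n"
    unfolding avoiders_231 free231_words_def by simp
  then show ?thesis
    using sum_free231_words(1)[of 0 0 q t r n]
    by (simp add: weight231_def free231_words_def fmax_eq_fmax_above)
qed

subsection \<open>Reversal and complementation\<close>

definition complement :: "nat \<Rightarrow> nat list \<Rightarrow> nat list" where
  "complement n xs = map (\<lambda>v. n + 1 - v) xs"

lemma perms_length: "xs \<in> perms n \<Longrightarrow> length xs = n"
  by (auto simp: perms_def dest!: distinct_card)

lemma perms_nth: "xs \<in> perms n \<Longrightarrow> i < n \<Longrightarrow> xs ! i \<in> {1..n}"
  using perms_length[of xs n] nth_mem[of i xs] by (auto simp: perms_def)

lemma complement_in_perms:
  assumes "xs \<in> perms n"
  shows "complement n xs \<in> perms n"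
proof -
  have "(\<lambda>v. n + 1 - v) ` {1..n} = {1..n}"
  proof (intro equalityI subsetI)
    fix y assume "y \<in> {1..n}"
    then show "y \<in> (\<lambda>v. n + 1 - v) ` {1..n}"
      by (intro image_eqI[of _ _ "n + 1 - y"]) auto
  qed auto
  then show ?thesis
    using assms by (auto simp: perms_def complement_def distinct_map inj_on_def)
qed

lemma complement_complement: "xs \<in> perms n \<Longrightarrow> complement n (complement n xs) = xs"
  by (auto simp: complement_def perms_def intro!: map_idI)

lemma length_complement [simp]: "length (complement n xs) = length xs"
  by (simp add: complement_def)

lemma complement_nth_less:
  assumes "xs \<in> perms n" "i < n" "j < n"
  shows "complement n xs ! i < complement n xs ! j \<longleftrightarrow> xs ! j < xs ! i"
  using assms perms_nth[OF assms(1,2)] perms_nth[OF assms(1,3)] perms_length[OF assms(1)]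
  by (auto simp: complement_def)

lemma rev_in_perms: "rev xs \<in> perms n \<longleftrightarrow> xs \<in> perms n"
  by (simp add: perms_def)

text \<open>Only the comparisons within a pattern matter, so a', b', c' may be any letters in the
  opposite order.\<close>

lemma contains_3_complement:
  assumes "xs \<in> perms n"
    and "a' < b' \<longleftrightarrow> b < a" "b' < a' \<longleftrightarrow> a < b" "a' < c' \<longleftrightarrow> c < a" "c' < a' \<longleftrightarrow> a < c"
      "b' < c' \<longleftrightarrow> c < b" "c' < b' \<longleftrightarrow> b < c"
  shows "contains [a', b', c'] (complement n xs) \<longleftrightarrow> contains [a, b, c] xs"
  unfolding contains_3_iff length_complement perms_length[OF assms(1)]
proof (intro ex_cong1)
  fix i j k
  let ?f = "complement n xs"
  let ?L = "(?f ! i < ?f ! j \<longleftrightarrow> a' < b') \<and> (?f ! j < ?f ! i \<longleftrightarrow> b' < a') \<and>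
     (?f ! i < ?f ! k \<longleftrightarrow> a' < c') \<and> (?f ! k < ?f ! i \<longleftrightarrow> c' < a') \<and>
     (?f ! j < ?f ! k \<longleftrightarrow> b' < c') \<and> (?f ! k < ?f ! j \<longleftrightarrow> c' < b')"
  let ?R = "(xs ! i < xs ! j \<longleftrightarrow> a < b) \<and> (xs ! j < xs ! i \<longleftrightarrow> b < a) \<and>
     (xs ! i < xs ! k \<longleftrightarrow> a < c) \<and> (xs ! k < xs ! i \<longleftrightarrow> c < a) \<and>
     (xs ! j < xs ! k \<longleftrightarrow> b < c) \<and> (xs ! k < xs ! j \<longleftrightarrow> c < b)"
  have "?L \<longleftrightarrow> ?R" if "i < j" "j < k" "k < n"
  proof -
    have "i < n" "j < n" using that by auto
    note complement_nth_less[OF assms(1) \<open>i < n\<close> \<open>j < n\<close>] complement_nth_less[OF assms(1) \<open>j < n\<close> \<open>i < n\<close>]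
      complement_nth_less[OF assms(1) \<open>i < n\<close> \<open>k < n\<close>] complement_nth_less[OF assms(1) \<open>k < n\<close> \<open>i < n\<close>]
      complement_nth_less[OF assms(1) \<open>j < n\<close> \<open>k < n\<close>] complement_nth_less[OF assms(1) \<open>k < n\<close> \<open>j < n\<close>]
    then show ?thesis
      by (simp only: assms(2-) conj_ac)
  qed
  note main = this
  \<comment> \<open>The comparisons are equivalent only for valid indices, which the preceding
    conjuncts guarantee.\<close>
  have lift: "P \<and> Q \<and> R \<and> L \<longleftrightarrow> P \<and> Q \<and> R \<and> M" if "P \<Longrightarrow> Q \<Longrightarrow> R \<Longrightarrow> L \<longleftrightarrow> M"
    for P Q R L M using that by blast
  show "i < j \<and> j < k \<and> k < n \<and> ?L \<longleftrightarrow> i < j \<and> j < k \<and> k < n \<and> ?R"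
    by (rule lift) (rule main)
qed

lemma contains_3_rev_aux:
  assumes "contains [a, b, c] xs"
  shows "contains [c, b, a] (rev xs)"
proof -
  let ?l = "length xs"
  obtain i j k where *: "i < j" "j < k" "k < ?l"
     "(xs ! i < xs ! j \<longleftrightarrow> a < b) \<and> (xs ! j < xs ! i \<longleftrightarrow> b < a) \<and>
      (xs ! i < xs ! k \<longleftrightarrow> a < c) \<and> (xs ! k < xs ! i \<longleftrightarrow> c < a) \<and>
      (xs ! j < xs ! k \<longleftrightarrow> b < c) \<and> (xs ! k < xs ! j \<longleftrightarrow> c < b)"
    using assms unfolding contains_3_iff by blast
  then have nth: "rev xs ! (?l - Suc k) = xs ! k" "rev xs ! (?l - Suc j) = xs ! j"
      "rev xs ! (?l - Suc i) = xs ! i"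
    by (simp_all add: rev_nth)
  have "?l - Suc k < ?l - Suc j" "?l - Suc j < ?l - Suc i" "?l - Suc i < length (rev xs)"
    using *(1-3) by auto
  then show ?thesis
    unfolding contains_3_iff
    by (intro exI[of _ "?l - Suc k"] exI[of _ "?l - Suc j"] exI[of _ "?l - Suc i"])
       (simp only: nth *(4) simp_thms)
qed

lemma contains_3_rev: "contains [c, b, a] (rev xs) \<longleftrightarrow> contains [a, b, c] xs"
  using contains_3_rev_aux[of a b c xs] contains_3_rev_aux[of c b a "rev xs"] by auto

lemma sum_avoiders_rev:
  "(\<Sum>\<sigma>\<in>avoiders n [c, b, a]. f \<sigma>) = (\<Sum>\<sigma>\<in>avoiders n [a, b, c]. f (rev \<sigma>))"
  by (rule sum.reindex_bij_witness[of _ rev rev])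
     (auto simp: avoiders_def rev_in_perms contains_3_rev)

lemma sum_avoiders_complement:
  assumes "a' < b' \<longleftrightarrow> b < a" "b' < a' \<longleftrightarrow> a < b" "a' < c' \<longleftrightarrow> c < a" "c' < a' \<longleftrightarrow> a < c"
      "b' < c' \<longleftrightarrow> c < b" "c' < b' \<longleftrightarrow> b < c"
  shows "(\<Sum>\<sigma>\<in>avoiders n [a', b', c']. f \<sigma>) = (\<Sum>\<sigma>\<in>avoiders n [a, b, c]. f (complement n \<sigma>))"
proof (rule sum.reindex_bij_witness[of _ "complement n" "complement n"])
  fix \<sigma> assume "\<sigma> \<in> avoiders n [a', b', c']"
  then have \<sigma>: "\<sigma> \<in> perms n" "\<not> contains [a', b', c'] \<sigma>" by (auto simp: avoiders_def)
  show "complement n (complement n \<sigma>) = \<sigma>" using \<sigma>(1) by (rule complement_complement)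
  then show "complement n \<sigma> \<in> avoiders n [a, b, c]"
    using \<sigma> contains_3_complement[OF complement_in_perms[OF \<sigma>(1)] assms]
    by (simp add: avoiders_def complement_in_perms)
  show "f (complement n (complement n \<sigma>)) = f \<sigma>" using \<sigma>(1) by (simp add: complement_complement)
next
  fix \<sigma> assume "\<sigma> \<in> avoiders n [a, b, c]"
  then have \<sigma>: "\<sigma> \<in> perms n" "\<not> contains [a, b, c] \<sigma>" by (auto simp: avoiders_def)
  show "complement n (complement n \<sigma>) = \<sigma>" using \<sigma>(1) by (rule complement_complement)
  show "complement n \<sigma> \<in> avoiders n [a', b', c']"
    using \<sigma> contains_3_complement[OF \<sigma>(1) assms] by (simp add: avoiders_def complement_in_perms)
qed

text \<open>Complementation reverses every comparison of letters and exchanges the boundary values 0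
  and infinity, while all indices stay in place.\<close>

lemma statistics_complement:
  assumes "xs \<in> perms n"
  shows "des (complement n xs) = asc xs" "asc (complement n xs) = des xs"
    "vinc_2_31 (complement n xs) = vinc_2_13 xs" "vinc_13_2 (complement n xs) = vinc_31_2 xs"
    "amin (complement n xs) = amax xs" "fmin (complement n xs) = fmax xs"
proof -
  note l = perms_length[OF assms] and less = complement_nth_less[OF assms]
  show "des (complement n xs) = asc xs" "asc (complement n xs) = des xs"
    unfolding des_def asc_def by (rule arg_cong[of _ _ card], auto simp: l less)+
  show "vinc_2_31 (complement n xs) = vinc_2_13 xs" "vinc_13_2 (complement n xs) = vinc_31_2 xs"
    unfolding vinc_2_31_def vinc_2_13_def vinc_13_2_def vinc_31_2_def
    by (rule arg_cong[of _ _ card], auto simp: l less)+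
  have "dasc (complement n xs) a \<longleftrightarrow> ddes xs a" "ddes (complement n xs) a \<longleftrightarrow> dasc xs a" for a
    unfolding dasc_def ddes_def by (cases "a < n"; cases "a + 1 = n"; auto simp: l less)+
  moreover have "rlmin (complement n xs) a \<longleftrightarrow> rlmax xs a" "lrmin (complement n xs) a \<longleftrightarrow> lrmax xs a" if "a < n" for a
    using that unfolding rlmin_def rlmax_def lrmin_def lrmax_def by (auto simp: l less)
  moreover have "a < n" if "ddes xs a \<or> dasc xs a" for a
    using that l by (auto simp: ddes_def dasc_def)
  ultimately show "amin (complement n xs) = amax xs" "fmin (complement n xs) = fmax xs"
    unfolding amin_def amax_def fmin_def fmax_def by (intro arg_cong[of _ _ card]; blast)+
qed

lemma card_reflect:
  fixes m :: nat
  shows "card {a. a < m \<and> P (m - Suc a)} = card {a. a < m \<and> P a}"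
proof -
  have "bij_betw (\<lambda>a. m - Suc a) {a. a < m \<and> P (m - Suc a)} {a. a < m \<and> P a}"
    by (rule bij_betw_byWitness[where f' = "\<lambda>a. m - Suc a"]) (auto simp: Suc_diff_Suc)
  then show ?thesis by (rule bij_betw_same_card)
qed

text \<open>Two bounds are needed for vincular patterns: in a word of length l an adjacent pair has
  l - 1 possible starting indices, a single letter has l.\<close>

lemma card_reflect2:
  fixes m m' :: nat
  shows "card {(a, b). a < m \<and> b < m' \<and> P (m - Suc a) (m' - Suc b)} =
    card {(a, b). a < m \<and> b < m' \<and> P a b}"
proof -
  have "bij_betw (map_prod (\<lambda>a. m - Suc a) (\<lambda>b. m' - Suc b))
     {(a, b). a < m \<and> b < m' \<and> P (m - Suc a) (m' - Suc b)} {(a, b). a < m \<and> b < m' \<and> P a b}"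
    by (rule bij_betw_byWitness[where f' = "map_prod (\<lambda>a. m - Suc a) (\<lambda>b. m' - Suc b)"])
       (auto simp: Suc_diff_Suc)
  then show ?thesis by (rule bij_betw_same_card)
qed

lemma statistics_rev:
  "asc (rev xs) = des xs" "vinc_2_13 (rev xs) = vinc_31_2 xs" "amax (rev xs) = fmax xs"
proof -
  define l where "l = length xs"
  have nth: "rev xs ! a = xs ! (l - Suc a)" if "a < l" for a
    using that by (simp add: rev_nth l_def)
  \<comment> \<open>Reversal swaps the two members of an adjacent pair and reflects its starting
    index within l - 1 indices.\<close>
  have nth1: "rev xs ! a = xs ! (l - 1 - Suc a + 1)" "rev xs ! (a + 1) = xs ! (l - 1 - Suc a)"
    if "a < l - 1" for a
  proof -
    have "l - 1 - Suc a + 1 = l - Suc a" "l - 1 - Suc a = l - Suc (a + 1)" "a < l" "a + 1 < l"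
      using that by auto
    then show "rev xs ! a = xs ! (l - 1 - Suc a + 1)" "rev xs ! (a + 1) = xs ! (l - 1 - Suc a)"
      by (simp_all only: nth)
  qed
  have lt: "a + 1 < l \<longleftrightarrow> a < l - 1" for a by auto
  have "asc (rev xs) = card {a. a < l - 1 \<and> xs ! (l - 1 - Suc a) > xs ! (l - 1 - Suc a + 1)}"
    unfolding asc_def length_rev l_def[symmetric] lt
    by (rule arg_cong[of _ _ card], rule Collect_cong, rule conj_cong[OF refl]) (simp only: nth1)
  also have "\<dots> = des xs"
    unfolding des_def l_def[symmetric] lt by (rule card_reflect)
  finally show "asc (rev xs) = des xs" .
  have "vinc_2_13 (rev xs) = card {(a, b). a < l - 1 \<and> b < l \<and> (l - 1 - Suc a + 1 < l - Suc b \<and>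
      xs ! (l - 1 - Suc a + 1) < xs ! (l - Suc b) \<and> xs ! (l - Suc b) < xs ! (l - 1 - Suc a))}"
  proof -
    have "b < a \<and> a + 1 < length (rev xs) \<and> rev xs ! a < rev xs ! b \<and> rev xs ! b < rev xs ! (a + 1) \<longleftrightarrow>
      a < l - 1 \<and> b < l \<and> (l - 1 - Suc a + 1 < l - Suc b \<and>
      xs ! (l - 1 - Suc a + 1) < xs ! (l - Suc b) \<and> xs ! (l - Suc b) < xs ! (l - 1 - Suc a))" for a b
    proof (cases "a < l - 1 \<and> b < l")
      case True
      then have "b < a \<longleftrightarrow> l - 1 - Suc a + 1 < l - Suc b" by linarith
      then show ?thesis
        using True nth1[of a] nth[of b] by (simp only: length_rev l_def[symmetric] lt simp_thms)
    next
      case False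
      then show ?thesis by (auto simp: l_def)
    qed
    then show ?thesis unfolding vinc_2_13_def by simp
  qed
  also have "\<dots> = card {(a, b). a < l - 1 \<and> b < l \<and> (a + 1 < b \<and> xs ! (a + 1) < xs ! b \<and> xs ! b < xs ! a)}"
    by (rule card_reflect2)
  also have "\<dots> = vinc_31_2 xs"
    unfolding vinc_31_2_def l_def by (rule arg_cong[of _ _ card]) auto
  finally show "vinc_2_13 (rev xs) = vinc_31_2 xs" .
  have "ddes (rev xs) a \<and> rlmax (rev xs) a \<longleftrightarrow>
      a < l \<and> (dasc xs (l - Suc a) \<and> lrmax xs (l - Suc a))" for a
  proof (cases "a < l")
    case True
    have "rlmax (rev xs) a \<longleftrightarrow> lrmax xs (l - Suc a)"
    proof
      assume *: "rlmax (rev xs) a"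
      have "xs ! b < xs ! (l - Suc a)" if "b < l - Suc a" for b
      proof -
        have "a < l - Suc b \<and> l - Suc b < length (rev xs)" "l - Suc (l - Suc b) = b" "l - Suc b < l"
          using that by (auto simp: l_def)
        then show ?thesis
          using * nth[OF True] nth[of "l - Suc b"] by (auto simp only: rlmax_def)
      qed
      then show "lrmax xs (l - Suc a)" by (simp add: lrmax_def)
    next
      assume *: "lrmax xs (l - Suc a)"
      have "rev xs ! b < rev xs ! a" if "a < b" "b < length (rev xs)" for b
      proof -
        have "b < l" "l - Suc b < l - Suc a" using that by (auto simp: l_def)
        then show ?thesis
          using * by (simp add: lrmax_def nth True)
      qed
      then show "rlmax (rev xs) a" by (simp add: rlmax_def)
    qed
    \<comment> \<open>The boundary conventions fit: infinity on the left and 0 on the right become 0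
      on the left and infinity on the right.\<close>
    moreover have "ddes (rev xs) a \<longleftrightarrow> dasc xs (l - Suc a)"
    proof -
      have "a = 0 \<or> rev xs ! a < rev xs ! (a - 1) \<longleftrightarrow>
          l - Suc a + 1 = l \<or> xs ! (l - Suc a) < xs ! (l - Suc a + 1)"
      proof (cases a)
        case (Suc a')
        have "l - Suc a + 1 = l - Suc a'" "a' < l" "l - Suc a' \<noteq> l" using True Suc by auto
        then show ?thesis using Suc True by (simp add: nth)
      qed (use True in simp)
      moreover have "a + 1 = l \<or> rev xs ! (a + 1) < rev xs ! a \<longleftrightarrow>
          l - Suc a = 0 \<or> xs ! (l - Suc a - 1) < xs ! (l - Suc a)"
      proof (cases "a + 1 = l")
        case False
        then have "a + 1 < l" using True by simp
        then show ?thesis using nth[OF True] nth[of "a + 1"] by auto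
      qed auto
      ultimately show ?thesis
        using True unfolding ddes_def dasc_def length_rev l_def[symmetric] by auto
    qed
    ultimately show ?thesis using True by simp
  qed (simp add: ddes_def l_def)
  then have "amax (rev xs) = card {a. a < l \<and> (dasc xs (l - Suc a) \<and> lrmax xs (l - Suc a))}"
    unfolding amax_def by simp
  also have "\<dots> = card {a. a < l \<and> (dasc xs a \<and> lrmax xs a)}"
    by (rule card_reflect)
  also have "\<dots> = fmax xs"
    unfolding fmax_def l_def by (rule arg_cong[of _ _ card]) (auto simp: dasc_def)
  finally show "amax (rev xs) = fmax xs" .
qed

lemma sum_avoiders_132:
  fixes q t r :: "'a::field"
  shows "(\<Sum>\<sigma>\<in>avoiders n [1,3,2]. t ^ asc \<sigma> * q ^ (asc \<sigma> + vinc_2_13 \<sigma>) * r ^ amax \<sigma>) = avoider_gf q t r $ n"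
  by (subst sum_avoiders_rev) (simp only: statistics_rev sum_avoiders_231)

text \<open>213 is the complement of 231.\<close>

lemma sum_avoiders_213:
  fixes q t r :: "'a::field"
  shows "(\<Sum>\<sigma>\<in>avoiders n [2,1,3]. t ^ asc \<sigma> * q ^ (asc \<sigma> + vinc_13_2 \<sigma>) * r ^ fmin \<sigma>) = avoider_gf q t r $ n"
proof -
  have "(\<Sum>\<sigma>\<in>avoiders n [2,1,3]. t ^ asc \<sigma> * q ^ (asc \<sigma> + vinc_13_2 \<sigma>) * r ^ fmin \<sigma>) =
    (\<Sum>\<sigma>\<in>avoiders n [2,3,1]. t ^ des \<sigma> * q ^ (des \<sigma> + vinc_31_2 \<sigma>) * r ^ fmax \<sigma>)"
    by (subst sum_avoiders_complement[where a' = 2 and b' = 1 and c' = 3 and a = 2 and b = 3 and c = 1])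
       (simp_all, intro sum.cong refl, simp add: avoiders_def statistics_complement)
  then show ?thesis by (simp only: sum_avoiders_231)
qed

text \<open>312 is the complement of 132, so it is reached from 231 by reversal and then
  complementation.\<close>

lemma sum_avoiders_312:
  fixes q t r :: "'a::field"
  shows "(\<Sum>\<sigma>\<in>avoiders n [3,1,2]. t ^ des \<sigma> * q ^ (des \<sigma> + vinc_2_31 \<sigma>) * r ^ amin \<sigma>) = avoider_gf q t r $ n"
proof -
  have "(\<Sum>\<sigma>\<in>avoiders n [3,1,2]. t ^ des \<sigma> * q ^ (des \<sigma> + vinc_2_31 \<sigma>) * r ^ amin \<sigma>) =
    (\<Sum>\<sigma>\<in>avoiders n [1,3,2]. t ^ asc \<sigma> * q ^ (asc \<sigma> + vinc_2_13 \<sigma>) * r ^ amax \<sigma>)"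
    by (subst sum_avoiders_complement[where a' = 3 and b' = 1 and c' = 2 and a = 1 and b = 3 and c = 2])
       (simp_all, intro sum.cong refl, simp add: avoiders_def statistics_complement)
  then show ?thesis by (simp only: sum_avoiders_132)
qed

section \<open>Comparison of coefficients in the two specialisations of A\<close>

theorem theorem3p12:
  fixes n :: nat and t q :: "'a::field"
  assumes "n \<ge> 1"
  shows "\<forall>(\<tau>, s1, s2, s3) \<in>
     {([3,2,1], exc, inv, fixpts),
      ([2,3,1], des, \<lambda>\<sigma>. des \<sigma> + vinc_31_2 \<sigma>, fmax),
      ([1,3,2], asc, \<lambda>\<sigma>. asc \<sigma> + vinc_2_13 \<sigma>, amax),
      ([3,1,2], des, \<lambda>\<sigma>. des \<sigma> + vinc_2_31 \<sigma>, amin),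
      ([2,1,3], asc, \<lambda>\<sigma>. asc \<sigma> + vinc_13_2 \<sigma>, fmin)}.
     (q \<noteq> 0 \<longrightarrow> N n (t / q) q 1 =
        (\<Sum>\<sigma>\<in>avoiders (n - 1) \<tau>. t ^ s1 \<sigma> * q ^ s2 \<sigma> * (1 + t) ^ s3 \<sigma>)) \<and>
     (t \<noteq> 0 \<longrightarrow> N n t q t = t ^ n *
        (\<Sum>\<sigma>\<in>avoiders (n - 1) \<tau>. (q / t) ^ s1 \<sigma> * q ^ s2 \<sigma> * (1 + q / t) ^ s3 \<sigma>))"
proof -
  obtain m where n: "n = Suc m" using assms by (cases n) auto
  have "N n (t / q) q 1 = avoider_gf q t (1 + t) $ (n - 1)" if "q \<noteq> 0"
    unfolding N_def sum_avoiders_321 avoider_gf_first[OF that] n by simp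
  \<comment> \<open>Dilation by t contributes t^(n-1) to this coefficient, and the factor t in front
    completes t^n.\<close>
  moreover have "N n t q t = t ^ n * avoider_gf q (q / t) (1 + q / t) $ (n - 1)" if "t \<noteq> 0"
    unfolding N_def sum_avoiders_321 avoider_gf_second[OF that] n
    by (simp only: fps_add_nth const_X_mult_nth) (simp add: dilate_nth)
  ultimately show ?thesis
    by (simp only: ball_simps prod.case sum_avoiders_321 sum_avoiders_231 sum_avoiders_132 sum_avoiders_312 sum_avoiders_213) simp
qed

end
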